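(* Let $k,l,m,n,r$ be integers with $0<r\le k\le m$ and $r\le l\le n$. Let $G$ be a $k\times m$ Gaussian matrix, let $H$ be an $n\times l$ Gaussian matrix (independent of $G$), and let $W$ be a well-conditioned $m\times n$ matrix of rank $r$. Then (i) $GW$ is a left factor-Gaussian matrix of expected rank $r$, $\|GW\|\le\|W\|\,\nu_{k,r}$, and $\|(GW)^+\|\le\|W^+\|\,\nu_{k,r}^+$; (ii) $WH$ is a right factor-Gaussian matrix of expected rank $r$, $\|WH\|\le\|W\|\,\nu_{r,l}$, and $\|(WH)^+\|\le\|W^+\|\,\nu_{r,l}^+$; (iii) $GWH$ is a diagonally scaled factor-Gaussian matrix of expected rank $r$, $\|GWH\|\le\|W\|\,\nu_{k,r}\nu_{r,l}$, and $\|(GWH)^+\|\le\|W^+\|\,\nu_{k,r}^+\nu_{r,l}^+$.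
   Context: $\|\cdot\|$ is the spectral norm and $M^+$ is the Moore–Penrose pseudo inverse. A matrix is Gaussian if its entries are i.i.d. standard Gaussian random variables. $\nu_{p,q}$ and $\nu_{p,q}^+$ denote the random variables $\|F\|$ and $\|F^+\|$, respectively, for a $p\times q$ Gaussian matrix $F$; inequalities with $\nu_{p,q}$, $\nu_{p,q}^+$ are understood for suitable Gaussian matrices of the indicated sizes defined on the same probability space (in a given part, $\nu_{k,r}$ and $\nu_{k,r}^+$ refer to the same $k\times r$ Gaussian matrix, and $\nu_{r,l}$ and $\nu_{r,l}^+$ to the same $r\times l$ Gaussian matrix). Gaussian matrices involved are assumed to have full rank, which holds with probability $1$. A matrix is well-conditioned if its condition number $\kappa(W)=\|W\|\,\|W^+\|$ is reasonably bounded (no specific threshold is fixed). A $p\times q$ matrix is left factor-Gaussian of expected rank $r$ if it equals $\bar G B$ with $\bar G$ a $p\times r$ Gaussian matrix and $B\in\mathbb C^{r\times q}$ a well-conditioned matrix of full rank $r$. It is right factor-Gaussian of expected rank $r$ if it equals $A\bar H$ with $A\in\mathbb C^{p\times r}$ well-conditioned of full rank $r$ and $\bar H$ an $r\times q$ Gaussian matrix. It is diagonally scaled factor-Gaussian of expected rank $r$ if it equals $\bar G\Sigma\bar H$ with $\bar G$ a $p\times r$ Gaussian matrix, $\bar H$ an $r\times q$ Gaussian matrix, and $\Sigma=\mathrm{diag}(\sigma_i)_{i=1}^r$, $\sigma_1\ge\dots\ge\sigma_r>0$, where the ratio $\sigma_1/\sigma_r$ is not large (that is, $\Sigma$ is well-conditioned).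 *)

theory Defs
  imports "HOL-Probability.Probability"
begin

text \<open>
  All matrices are complex. The parameter \<open>\<FF>\<close> says whether the underlying field is
  \<open>\<real>\<close> (real standard Gaussian entries, real data matrices) or \<open>\<complex>\<close>
  (complex standard Gaussian entries, arbitrary data matrices). A \<open>p \<times> q\<close> matrix has type
  \<open>complex^'q^'p\<close> with \<open>p = CARD('p)\<close> and \<open>q = CARD('q)\<close>.
\<close>

datatype base_field = Real_Field | Complex_Field

fun scalars :: "base_field \<Rightarrow> complex set" where
  "scalars Real_Field = \<real>"
| "scalars Complex_Field = UNIV"

definition matrix_over :: "base_field \<Rightarrow> complex^'q^'p \<Rightarrow> bool" where
  "matrix_over \<FF> A \<longleftrightarrow> (\<forall>i j. A $ i $ j \<in> scalars \<FF>)"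

text \<open>
  The complex case is the circularly symmetric law with \<open>E|z|\<^sup>2 = 1\<close>: real and imaginary part
  are independent centred normal variables of variance \<open>1/2\<close>.
\<close>

fun standard_gaussian :: "base_field \<Rightarrow> complex measure" where
  "standard_gaussian Real_Field = distr (density lborel (\<lambda>x. ennreal (std_normal_density x))) borel complex_of_real"
| "standard_gaussian Complex_Field = density lborel (\<lambda>z. ennreal (exp (- (cmod z)\<^sup>2) / pi))"

definition gaussian_matrix ::
    "base_field \<Rightarrow> 'o measure \<Rightarrow> ('o \<Rightarrow> complex^'q^'p) \<Rightarrow> bool" where
  "gaussian_matrix \<FF> M F \<longleftrightarrow>
     prob_space.indep_vars M (\<lambda>_. borel) (\<lambda>(i, j) \<omega>. F \<omega> $ i $ j) UNIV \<and>
     (\<forall>i j. distr M borel (\<lambda>\<omega>. F \<omega> $ i $ j) = standard_gaussian \<FF>)"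

text \<open>
  Independence of the generated \<open>\<sigma>\<close>-algebras; \<open>indep_var\<close> is not applicable because
  it requires both variables to have the same type, that is, the same matrix format.
\<close>

definition independent_matrices ::
    "'o measure \<Rightarrow> ('o \<Rightarrow> complex^'q^'p) \<Rightarrow> ('o \<Rightarrow> complex^'t^'s) \<Rightarrow> bool" where
  "independent_matrices M X Y \<longleftrightarrow>
     prob_space.indep_set M (sets (vimage_algebra (space M) X borel))
                            (sets (vimage_algebra (space M) Y borel))"

definition spectral_norm :: "complex^'q^'p \<Rightarrow> real" where
  "spectral_norm A = onorm (\<lambda>x. A *v x)"

definition conj_transpose :: "complex^'q^'p \<Rightarrow> complex^'p^'q" where
  "conj_transpose A = (\<chi> i j. cnj (A $ j $ i))"

text \<open>The Moore--Penrose inverse, as the unique solution of the four Penrose equations.\<close>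

definition pinv :: "complex^'q^'p \<Rightarrow> complex^'p^'q" where
  "pinv A = (THE X. A ** X ** A = A \<and> X ** A ** X = X \<and>
     conj_transpose (A ** X) = A ** X \<and> conj_transpose (X ** A) = X ** A)"

definition condition_number :: "complex^'q^'p \<Rightarrow> real" where
  "condition_number A = spectral_norm A * spectral_norm (pinv A)"

text \<open>Well-conditioned relative to an explicit threshold \<open>c\<close>.\<close>

definition well_conditioned :: "real \<Rightarrow> complex^'q^'p \<Rightarrow> bool" where
  "well_conditioned c A \<longleftrightarrow> condition_number A \<le> c"

definition diagonal_matrix :: "('r \<Rightarrow> real) \<Rightarrow> complex^'r^'r" where
  "diagonal_matrix \<sigma> = (\<chi> i j. if i = j then complex_of_real (\<sigma> i) else 0)"

text \<open>
  The type argument of the following predicates carries the expected rank \<open>r = CARD('r)\<close>.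
  As in \<^term>\<open>well_conditioned c\<close>, the threshold \<open>c\<close> bounds the condition number of the
  nonrandom factor.
\<close>

definition left_factor_gaussian ::
    "'r::finite itself \<Rightarrow> base_field \<Rightarrow> real \<Rightarrow> 'o measure \<Rightarrow> ('o \<Rightarrow> complex^'q^'p) \<Rightarrow> bool" where
  "left_factor_gaussian _ \<FF> c M X \<longleftrightarrow>
     (\<exists>(G :: 'o \<Rightarrow> complex^'r^'p) (B :: complex^'q^'r).
        gaussian_matrix \<FF> M G \<and> rank B = CARD('r) \<and> well_conditioned c B \<and>
        (\<forall>\<omega>\<in>space M. X \<omega> = G \<omega> ** B))"

definition right_factor_gaussian ::
    "'r::finite itself \<Rightarrow> base_field \<Rightarrow> real \<Rightarrow> 'o measure \<Rightarrow> ('o \<Rightarrow> complex^'q^'p) \<Rightarrow> bool" where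
  "right_factor_gaussian _ \<FF> c M X \<longleftrightarrow>
     (\<exists>(A :: complex^'r^'p) (H :: 'o \<Rightarrow> complex^'q^'r).
        gaussian_matrix \<FF> M H \<and> rank A = CARD('r) \<and> well_conditioned c A \<and>
        (\<forall>\<omega>\<in>space M. X \<omega> = A ** H \<omega>))"

text \<open>
  The linear order on \<open>'r\<close> provides the enumeration \<open>1, \<dots>, r\<close> of the diagonal;
  \<open>Min UNIV\<close> and \<open>Max UNIV\<close> are its first and last index.
\<close>

definition diagonally_scaled_factor_gaussian ::
    "'r::{finite,linorder} itself \<Rightarrow> base_field \<Rightarrow> real \<Rightarrow> 'o measure \<Rightarrow>
     ('o \<Rightarrow> complex^'q^'p) \<Rightarrow> bool" where
  "diagonally_scaled_factor_gaussian _ \<FF> c M X \<longleftrightarrow>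
     (\<exists>(G :: 'o \<Rightarrow> complex^('r::{finite,linorder})^'p) (\<sigma> :: 'r \<Rightarrow> real) (H :: 'o \<Rightarrow> complex^'q^('r::{finite,linorder})).
        gaussian_matrix \<FF> M G \<and> gaussian_matrix \<FF> M H \<and> independent_matrices M G H \<and>
        antimono \<sigma> \<and> (\<forall>i. \<sigma> i > 0) \<and> \<sigma> (Min UNIV) / \<sigma> (Max UNIV) \<le> c \<and>
        (\<forall>\<omega>\<in>space M. X \<omega> = G \<omega> ** diagonal_matrix \<sigma> ** H \<omega>))"

end

theory Submission
  imports Defs "HOL-Computational_Algebra.Polynomial"
begin

text \<open>
  Let \<open>W = U D V\<^sup>*\<close> be a thin singular value decomposition: \<open>U\<close> and \<open>V\<close> have \<open>r\<close> orthonormal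
  columns over the scalar field, and \<open>D\<close> is diagonal with the positive singular values in decreasing
  order (\<open>thin_singular_value_decomposition\<close>). Put \<open>F = G U\<close> and \<open>F' = V\<^sup>* H\<close>. Then
  \<open>G W = F (D V\<^sup>*)\<close>, \<open>W H = (U D) F'\<close> and \<open>G W H = F D F'\<close>, and everything follows from three facts.

  First, \<open>F\<close> and \<open>F'\<close> are Gaussian: an isotropic normal vector, projected orthogonally to a smaller
  space, is isotropic normal (\<open>isotropic_normal_coisometry\<close>). This rests on the invariance of
  Lebesgue measure under an isometric involution (\<open>lborel_distr_involutive_isometry\<close>), since
  the density depends only on the norm. Independence of \<open>F\<close> and \<open>F'\<close> is inherited from \<open>G\<close> and \<open>H\<close>.

  Second, \<open>F\<close> has independent columns and \<open>F'\<close> independent rows almost surely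
  (\<open>gaussian_matrix_AE_left_invertible\<close>): a matrix is singular for only finitely many shifts along a
  coordinate embedding, so by Fubini's theorem the singular matrices form a null set.

  Third, the reverse order law \<open>(X Y)\<^sup>+ = Y\<^sup>+ X\<^sup>+\<close> holds when \<open>X\<close> has independent columns and \<open>Y\<close>
  independent rows (\<open>pinv_mult_full_rank\<close>). The estimates are then submultiplicativity of the spectral
  norm. The factors \<open>D V\<^sup>* = U\<^sup>* W\<close>, \<open>U D = W V\<close>, \<open>D = U\<^sup>* W V\<close> and their Moore--Penrose inverses arise from
  \<open>W\<close> and \<open>pinv W = V D\<^sup>-\<^sup>1 U\<^sup>*\<close> by multiplication with matrices of norm at most \<open>1\<close>; hence their norms,
  and their condition numbers, are bounded by those of \<open>W\<close>.
\<close>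

section \<open>The Hermitian inner product and adjoints of complex matrices\<close>

definition hinner :: "complex^'n \<Rightarrow> complex^'n \<Rightarrow> complex" where
  "hinner x y = (\<Sum>i\<in>UNIV. x $ i * cnj (y $ i))"

lemma hinner_add_left: "hinner (x + y) z = hinner x z + hinner y z"
  by (simp add: hinner_def distrib_right sum.distrib)

lemma hinner_diff_left: "hinner (x - y) z = hinner x z - hinner y z"
  by (simp add: hinner_def left_diff_distrib sum_subtractf)

lemma hinner_scale_left: "hinner (c *s x) z = c * hinner x z"
  by (simp add: hinner_def sum_distrib_left mult.assoc)

lemma hinner_sum_left: "hinner (\<Sum>i\<in>I. f i) z = (\<Sum>i\<in>I. hinner (f i) z)"
  by (induction I rule: infinite_finite_induct) (simp_all add: hinner_add_left, simp_all add: hinner_def)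

lemma hinner_commute: "hinner y x = cnj (hinner x y)"
  by (simp add: hinner_def mult.commute)

lemma Re_hinner: "Re (hinner x y) = x \<bullet> y"
  by (simp add: hinner_def inner_vec_def inner_complex_def)

lemma hinner_self: "hinner x x = complex_of_real ((norm x)\<^sup>2)"
proof (rule complex_eqI)
  show "Im (hinner x x) = Im (complex_of_real ((norm x)\<^sup>2))"
    by (simp add: hinner_def mult.commute)
qed (simp add: Re_hinner power2_norm_eq_inner)

lemma hinner_axis: "hinner (axis i 1) y = cnj (y $ i)"
proof -
  have "axis i 1 $ j * cnj (y $ j) = (if j = i then cnj (y $ i) else 0)" for j
    by (simp add: axis_def)
  then show ?thesis
    by (simp add: hinner_def)
qed

lemma norm_scale_vec: "norm (c *s (x :: complex^'n)) = cmod c * norm x"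
  by (simp add: norm_vec_def norm_mult L2_set_right_distrib)

lemma norm_add_square: "(norm (x + y))\<^sup>2 = (norm x)\<^sup>2 + 2 * Re (hinner y x) + (norm y)\<^sup>2"
  unfolding Re_hinner power2_norm_eq_inner by (simp add: inner_add_left inner_add_right inner_commute)

lemma conj_transpose_mult: "conj_transpose (A ** B) = conj_transpose B ** conj_transpose A"
  by (simp add: conj_transpose_def matrix_matrix_mult_def vec_eq_iff mult.commute)

lemma conj_transpose_conj_transpose [simp]: "conj_transpose (conj_transpose A) = A"
  by (simp add: conj_transpose_def vec_eq_iff)

lemma conj_transpose_mat_1 [simp]: "conj_transpose (mat 1) = mat 1"
  by (auto simp: conj_transpose_def vec_eq_iff mat_def)

lemma hinner_matrix_left: "hinner (A *v x) y = hinner x (conj_transpose A *v y)"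
proof -
  have "hinner (A *v x) y = (\<Sum>i\<in>UNIV. \<Sum>j\<in>UNIV. A $ i $ j * x $ j * cnj (y $ i))"
    by (simp add: hinner_def matrix_vector_mult_def sum_distrib_right)
  also have "\<dots> = (\<Sum>j\<in>UNIV. \<Sum>i\<in>UNIV. A $ i $ j * x $ j * cnj (y $ i))"
    by (rule sum.swap)
  also have "\<dots> = hinner x (conj_transpose A *v y)"
    by (simp add: hinner_def matrix_vector_mult_def conj_transpose_def sum_distrib_left mult_ac)
  finally show ?thesis .
qed

lemma norm_isometry:
  assumes "conj_transpose U ** U = mat 1"
  shows "norm (U *v x) = norm x"
proof -
  have "hinner (U *v x) (U *v x) = hinner x x"
    using assms by (simp add: hinner_matrix_left matrix_vector_mul_assoc)
  then show ?thesis
    by (simp add: hinner_self power2_eq_iff_nonneg flip: of_real_power)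
qed

section \<open>Moore--Penrose inverses and spectral norms\<close>

lemma pinv_eqI:
  assumes "A ** X ** A = A" "X ** A ** X = X"
    and "conj_transpose (A ** X) = A ** X" "conj_transpose (X ** A) = X ** A"
  shows "pinv A = X"
  unfolding pinv_def
proof (rule the_equality)
  fix Y
  assume Y: "A ** Y ** A = A \<and> Y ** A ** Y = Y \<and>
     conj_transpose (A ** Y) = A ** Y \<and> conj_transpose (Y ** A) = Y ** A"
  have "A ** Y = (A ** X ** A) ** Y" by (simp add: assms)
  also have "\<dots> = (A ** X) ** (A ** Y)" by (simp add: matrix_mul_assoc)
  also have "\<dots> = conj_transpose ((A ** Y) ** (A ** X))"
    by (subst conj_transpose_mult) (use Y assms in simp)
  also have "\<dots> = conj_transpose (A ** X)" using Y by (simp add: matrix_mul_assoc)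
  finally have AYX: "A ** Y = A ** X" using assms by simp
  have "Y ** A = Y ** (A ** X ** A)" by (simp add: assms)
  also have "\<dots> = (Y ** A) ** (X ** A)" by (simp add: matrix_mul_assoc)
  also have "\<dots> = conj_transpose ((X ** A) ** (Y ** A))"
    by (subst conj_transpose_mult) (use Y assms in simp)
  also have "\<dots> = conj_transpose (X ** (A ** Y ** A))" by (simp add: matrix_mul_assoc)
  also have "\<dots> = X ** A" using Y assms by simp
  finally have YAX: "Y ** A = X ** A" .
  have "Y = Y ** A ** Y" using Y by simp
  also have "\<dots> = X ** (A ** Y)" by (simp add: YAX matrix_mul_assoc)
  also have "\<dots> = X" by (simp add: AYX assms matrix_mul_assoc)
  finally show "Y = X" .
qed (use assms in simp)

lemma invertible_gram_matrix:
  fixes A :: "complex^'q^'p"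
  assumes "L ** A = mat 1"
  shows "invertible (conj_transpose A ** A)"
proof -
  have "x = 0" if "(conj_transpose A ** A) *v x = 0" for x
  proof -
    have "hinner (A *v x) (A *v x) = hinner x ((conj_transpose A ** A) *v x)"
      by (simp add: hinner_matrix_left matrix_vector_mul_assoc)
    also have "\<dots> = 0" using that by (simp add: hinner_def)
    finally have "A *v x = 0" by (simp add: hinner_self)
    then have "(L ** A) *v x = 0" by (simp flip: matrix_vector_mul_assoc)
    then show "x = 0" using assms by simp
  qed
  then show ?thesis
    by (auto simp: invertible_left_inverse matrix_left_invertible_ker)
qed

text \<open>
  A matrix with independent columns has the Moore--Penrose inverse \<open>(A\<^sup>* A)\<^sup>-\<^sup>1 A\<^sup>*\<close>.
\<close>

lemma penrose_left_invertible:
  fixes A :: "complex^'q^'p"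
  assumes "L ** A = mat 1"
  shows "pinv A ** A = mat 1" "conj_transpose (A ** pinv A) = A ** pinv A"
proof -
  obtain K where K: "K ** (conj_transpose A ** A) = mat 1" "(conj_transpose A ** A) ** K = mat 1"
    using invertible_gram_matrix[OF assms] by (auto simp: invertible_def)
  have herm: "conj_transpose (conj_transpose A ** A) = conj_transpose A ** A"
    by (simp add: conj_transpose_mult)
  have "conj_transpose K = conj_transpose K ** ((conj_transpose A ** A) ** K)" by (simp add: K)
  also have "\<dots> = conj_transpose ((conj_transpose A ** A) ** K) ** K"
    by (simp add: conj_transpose_mult[of "conj_transpose A ** A"] herm matrix_mul_assoc)
  also have "\<dots> = K" by (simp add: K)
  finally have K_herm: "conj_transpose K = K" .
  let ?X = "K ** conj_transpose A"
  have XA: "?X ** A = mat 1" using K by (simp add: matrix_mul_assoc)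
  have AX: "conj_transpose (A ** ?X) = A ** ?X"
    by (simp add: conj_transpose_mult K_herm matrix_mul_assoc)
  have "A ** ?X ** A = A" using XA by (metis matrix_mul_assoc matrix_mul_rid)
  then have "pinv A = ?X" using XA AX by (intro pinv_eqI) simp_all
  then show "pinv A ** A = mat 1" "conj_transpose (A ** pinv A) = A ** pinv A"
    using XA AX by simp_all
qed

lemma pinv_conj_transpose:
  assumes "L ** A = mat 1"
  shows "pinv (conj_transpose A) = conj_transpose (pinv A)"
proof (rule pinv_eqI)
  note P = penrose_left_invertible[OF assms]
  show "conj_transpose A ** conj_transpose (pinv A) ** conj_transpose A = conj_transpose A"
    using P(1) by (simp flip: conj_transpose_mult)
  show "conj_transpose (pinv A) ** conj_transpose A ** conj_transpose (pinv A) = conj_transpose (pinv A)"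
    using P(1) by (metis conj_transpose_mult conj_transpose_mat_1 matrix_mul_assoc matrix_mul_rid)
qed (use penrose_left_invertible[OF assms] in \<open>simp_all flip: conj_transpose_mult\<close>)

lemma penrose_right_invertible:
  fixes B :: "complex^'q^'p"
  assumes "B ** R = mat 1"
  shows "B ** pinv B = mat 1" "conj_transpose (pinv B ** B) = pinv B ** B"
proof -
  let ?A = "conj_transpose B"
  have L: "conj_transpose R ** ?A = mat 1"
    using assms by (simp flip: conj_transpose_mult)
  have eq: "pinv B = conj_transpose (pinv ?A)"
    using pinv_conj_transpose[OF L] by simp
  have "conj_transpose (pinv ?A ** ?A) = mat 1"
    using penrose_left_invertible(1)[OF L] by simp
  then show "B ** pinv B = mat 1" by (simp add: conj_transpose_mult eq)
  have "pinv B ** B = conj_transpose (?A ** pinv ?A)" by (simp add: conj_transpose_mult eq)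
  then show "conj_transpose (pinv B ** B) = pinv B ** B"
    using penrose_left_invertible(2)[OF L] by simp
qed

text \<open>
  The reverse order law fails for general matrices; it needs the inner projections
  \<open>pinv A ** A\<close> and \<open>B ** pinv B\<close> to cancel, which full rank along the shared dimension provides.
\<close>

lemma pinv_mult_full_rank:
  fixes A :: "complex^'r^'p" and B :: "complex^'q^'r"
  assumes "L ** A = mat 1" "B ** R = mat 1"
  shows "pinv (A ** B) = pinv B ** pinv A"
proof (rule pinv_eqI)
  note A = penrose_left_invertible[OF assms(1)] and B = penrose_right_invertible[OF assms(2)]
  have AB: "A ** B ** (pinv B ** pinv A) = A ** pinv A"
    by (metis B(1) matrix_mul_assoc matrix_mul_rid)
  have BA: "pinv B ** pinv A ** (A ** B) = pinv B ** B"
    by (metis A(1) matrix_mul_assoc matrix_mul_rid)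
  show "conj_transpose (A ** B ** (pinv B ** pinv A)) = A ** B ** (pinv B ** pinv A)"
    using A by (simp add: AB)
  show "conj_transpose (pinv B ** pinv A ** (A ** B)) = pinv B ** pinv A ** (A ** B)"
    using B by (simp add: BA)
  show "A ** B ** (pinv B ** pinv A) ** (A ** B) = A ** B"
    unfolding AB by (metis A(1) matrix_mul_assoc matrix_mul_rid)
  show "pinv B ** pinv A ** (A ** B) ** (pinv B ** pinv A) = pinv B ** pinv A"
    unfolding BA by (metis B(1) matrix_mul_assoc matrix_mul_rid)
qed

lemma bounded_linear_complex_matrix: "bounded_linear (\<lambda>x. (A :: complex^'q^'p) *v x)"
  unfolding linear_conv_bounded_linear[symmetric]
  by (intro linearI)
     (simp_all add: vec_eq_iff matrix_vector_mult_def scaleR_sum_right distrib_left sum.distrib)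

lemma spectral_norm_mult: "spectral_norm (A ** B) \<le> spectral_norm A * spectral_norm B"
  using onorm_compose[OF bounded_linear_complex_matrix[of A] bounded_linear_complex_matrix[of B]]
  by (simp add: spectral_norm_def o_def matrix_vector_mul_assoc)

lemma spectral_norm_nonneg: "0 \<le> spectral_norm A"
  unfolding spectral_norm_def by (rule onorm_pos_le[OF bounded_linear_complex_matrix])

lemma spectral_norm_isometry:
  assumes "conj_transpose U ** U = mat 1"
  shows "spectral_norm U \<le> 1"
  unfolding spectral_norm_def by (rule onorm_bound) (simp_all add: norm_isometry[OF assms])

lemma spectral_norm_coisometry:
  assumes "conj_transpose U ** U = mat 1"
  shows "spectral_norm (conj_transpose U) \<le> 1"
  unfolding spectral_norm_def
proof (rule onorm_bound)
  fix x
  let ?y = "conj_transpose U *v x"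
  have "(norm ?y)\<^sup>2 = Re (hinner (U *v ?y) x)"
    by (simp add: hinner_matrix_left hinner_self)
  also have "\<dots> \<le> norm (U *v ?y) * norm x"
    unfolding Re_hinner by (rule norm_cauchy_schwarz)
  finally have "norm ?y * norm ?y \<le> norm ?y * norm x"
    by (simp add: norm_isometry[OF assms] power2_eq_square)
  then show "norm ?y \<le> 1 * norm x"
    by (cases "norm ?y = 0") simp_all
qed simp

lemma norm_column_le_spectral_norm: "norm (A *v axis j 1) \<le> spectral_norm A"
  using onorm[OF bounded_linear_complex_matrix[of A], of "axis j 1"]
  by (simp add: spectral_norm_def norm_axis_1)

section \<open>A thin singular value decomposition over the scalar field\<close>

definition vector_over :: "base_field \<Rightarrow> complex^'n \<Rightarrow> bool" where
  "vector_over \<FF> x \<longleftrightarrow> (\<forall>i. x $ i \<in> scalars \<FF>)"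

lemma scalars_closed:
  shows scalars_0: "0 \<in> scalars \<FF>" and scalars_1: "1 \<in> scalars \<FF>"
    and scalars_of_real: "complex_of_real t \<in> scalars \<FF>"
    and scalars_add: "a \<in> scalars \<FF> \<Longrightarrow> b \<in> scalars \<FF> \<Longrightarrow> a + b \<in> scalars \<FF>"
    and scalars_diff: "a \<in> scalars \<FF> \<Longrightarrow> b \<in> scalars \<FF> \<Longrightarrow> a - b \<in> scalars \<FF>"
    and scalars_mult: "a \<in> scalars \<FF> \<Longrightarrow> b \<in> scalars \<FF> \<Longrightarrow> a * b \<in> scalars \<FF>"
    and scalars_divide: "a \<in> scalars \<FF> \<Longrightarrow> b \<in> scalars \<FF> \<Longrightarrow> a / b \<in> scalars \<FF>"
    and scalars_cnj: "a \<in> scalars \<FF> \<Longrightarrow> cnj a \<in> scalars \<FF>"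
  by (cases \<FF>; auto simp: Reals_cnj_iff)+

lemma scalars_sum: "(\<And>i. i \<in> I \<Longrightarrow> f i \<in> scalars \<FF>) \<Longrightarrow> (\<Sum>i\<in>I. f i) \<in> scalars \<FF>"
  by (induction I rule: infinite_finite_induct) (simp_all add: scalars_0 scalars_add)

lemma closed_scalars: "closed (scalars \<FF>)"
  by (cases \<FF>) (simp_all add: closed_complex_Reals)

lemma vector_over_simps:
  shows vector_over_add: "vector_over \<FF> x \<Longrightarrow> vector_over \<FF> y \<Longrightarrow> vector_over \<FF> (x + y)"
    and vector_over_diff: "vector_over \<FF> x \<Longrightarrow> vector_over \<FF> y \<Longrightarrow> vector_over \<FF> (x - y)"
    and vector_over_scale: "c \<in> scalars \<FF> \<Longrightarrow> vector_over \<FF> x \<Longrightarrow> vector_over \<FF> (c *s x)"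
    and vector_over_axis: "vector_over \<FF> (axis i 1)"
  by (simp_all add: vector_over_def scalars_closed axis_def)

lemma vector_over_sum: "(\<And>i. i \<in> I \<Longrightarrow> vector_over \<FF> (f i)) \<Longrightarrow> vector_over \<FF> (\<Sum>i\<in>I. f i)"
  by (simp add: vector_over_def scalars_sum)

lemma hinner_in_scalars: "vector_over \<FF> x \<Longrightarrow> vector_over \<FF> y \<Longrightarrow> hinner x y \<in> scalars \<FF>"
  by (simp add: vector_over_def hinner_def scalars_sum scalars_mult scalars_cnj)

lemma vector_over_matrix: "matrix_over \<FF> A \<Longrightarrow> vector_over \<FF> x \<Longrightarrow> vector_over \<FF> (A *v x)"
  by (simp add: vector_over_def matrix_over_def matrix_vector_mult_def scalars_sum scalars_mult)

lemma matrix_over_conj_transpose: "matrix_over \<FF> A \<Longrightarrow> matrix_over \<FF> (conj_transpose A)"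
  by (simp add: matrix_over_def conj_transpose_def scalars_cnj)

lemma matrix_over_transpose: "matrix_over \<FF> A \<Longrightarrow> matrix_over \<FF> (transpose A)"
  by (simp add: matrix_over_def transpose_def)

lemma matrix_over_mult: "matrix_over \<FF> A \<Longrightarrow> matrix_over \<FF> B \<Longrightarrow> matrix_over \<FF> (A ** B)"
  by (simp add: matrix_over_def matrix_matrix_mult_def scalars_sum scalars_mult)

text \<open>
  First-order optimality: if \<open>v\<close> maximises \<open>norm (W *v z) / norm z\<close> along all lines through \<open>v\<close> in
  direction of \<open>x\<close>, then perturbing \<open>v\<close> along \<open>x\<close> cannot produce a term of first order, so \<open>W\<close> maps
  the orthogonal pair \<open>v\<close>, \<open>x\<close> to an orthogonal pair.
\<close>

lemma hinner_image_maximiser: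
  assumes W: "matrix_over \<FF> W" and v: "vector_over \<FF> v" "norm v = 1"
    and x: "vector_over \<FF> x" "hinner x v = 0"
    and max: "\<And>t. t \<in> scalars \<FF> \<Longrightarrow> norm (W *v (v + t *s x)) \<le> norm (W *v v) * norm (v + t *s x)"
  shows "hinner (W *v x) (W *v v) = 0"
proof (rule ccontr)
  define a where "a = hinner (W *v x) (W *v v)"
  define K where "K = (norm (W *v v))\<^sup>2 * (norm x)\<^sup>2"
  define s where "s = 1 / (K + 1)"
  assume "hinner (W *v x) (W *v v) \<noteq> 0"
  then have a: "a \<noteq> 0" by (simp add: a_def)
  have K: "K \<ge> 0" by (simp add: K_def)
  then have s: "s > 0" by (simp add: s_def)
  let ?t = "complex_of_real s * cnj a"
  have t: "?t \<in> scalars \<FF>"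
    unfolding a_def using W v x
    by (intro scalars_mult scalars_cnj scalars_of_real hinner_in_scalars vector_over_matrix)
  have ta: "?t * a = complex_of_real (s * (cmod a)\<^sup>2)"
    by (simp only: of_real_mult complex_norm_square mult_ac)
  have nt: "cmod ?t = s * cmod a" using s by (simp add: norm_mult)
  have "(norm (W *v v))\<^sup>2 + 2 * (s * (cmod a)\<^sup>2) \<le> (norm (W *v (v + ?t *s x)))\<^sup>2"
    unfolding matrix_vector_right_distrib vector_scalar_commute norm_add_square hinner_scale_left
    by (fold a_def) (simp add: ta del: of_real_mult of_real_power)
  also have "\<dots> \<le> (norm (W *v v) * norm (v + ?t *s x))\<^sup>2"
    using max[OF t] by (rule power_mono) simp
  also have "\<dots> = (norm (W *v v))\<^sup>2 * (1 + (s * cmod a * norm x)\<^sup>2)"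
    unfolding power_mult_distrib[of "norm (W *v v)"] norm_add_square hinner_scale_left
    by (simp add: v x norm_scale_vec nt)
  finally have "2 * (s * (cmod a)\<^sup>2) \<le> K * s * (s * (cmod a)\<^sup>2)"
    by (simp add: K_def power_mult_distrib power2_eq_square algebra_simps)
  then have "2 \<le> K * s" using a s by (simp add: mult_le_cancel_right)
  moreover have "K * s \<le> 1" using K by (simp add: s_def)
  ultimately show False by simp
qed

text \<open>
  Right singular vectors with their singular values \<open>norm (W *v v i)\<close> in decreasing order: every
  \<open>v i\<close> is a unit vector on which \<open>W\<close> stretches most among the vectors over \<open>\<FF>\<close> that are
  orthogonal to its predecessors.
\<close>

definition greedy_family :: "base_field \<Rightarrow> complex^'n^'m \<Rightarrow> nat \<Rightarrow> (nat \<Rightarrow> complex^'n) \<Rightarrow> bool" where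
  "greedy_family \<FF> W p v \<longleftrightarrow> (\<forall>i<p. vector_over \<FF> (v i) \<and> norm (v i) = 1 \<and> W *v v i \<noteq> 0 \<and>
     (\<forall>j<i. hinner (v i) (v j) = 0) \<and>
     (\<forall>x. vector_over \<FF> x \<and> (\<forall>j<i. hinner x (v j) = 0) \<longrightarrow>
        norm (W *v x) \<le> norm (W *v v i) * norm x))"

lemma greedy_familyD:
  assumes "greedy_family \<FF> W p v" "i < p"
  shows "vector_over \<FF> (v i)" "norm (v i) = 1" "W *v v i \<noteq> 0"
    and "\<And>j. j < i \<Longrightarrow> hinner (v i) (v j) = 0"
    and "\<And>x. vector_over \<FF> x \<Longrightarrow> (\<And>j. j < i \<Longrightarrow> hinner x (v j) = 0) \<Longrightarrow>
           norm (W *v x) \<le> norm (W *v v i) * norm x"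
  using assms by (auto simp: greedy_family_def)

lemma greedy_family_orthonormal:
  assumes "greedy_family \<FF> W p v" "i < p" "j < p"
  shows "hinner (v i) (v j) = (if i = j then 1 else 0)"
proof (cases i j rule: linorder_cases)
  case less
  then show ?thesis
    using greedy_familyD(4)[OF assms(1,3) less] by (subst hinner_commute) simp
qed (use greedy_familyD(2,4)[OF assms(1,2)] in \<open>simp_all add: hinner_self\<close>)

lemma greedy_family_image_orthogonal:
  assumes W: "matrix_over \<FF> W" and g: "greedy_family \<FF> W p v" and i: "i < p"
    and x: "vector_over \<FF> x" "\<And>j. j \<le> i \<Longrightarrow> hinner x (v j) = 0"
  shows "hinner (W *v x) (W *v v i) = 0"
proof (rule hinner_image_maximiser[OF W greedy_familyD(1,2)[OF g i] x(1)])
  fix t assume "t \<in> scalars \<FF>"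
  then show "norm (W *v (v i + t *s x)) \<le> norm (W *v v i) * norm (v i + t *s x)"
    using greedy_familyD(1,4)[OF g i] x
    by (intro greedy_familyD(5)[OF g i])
       (simp_all add: vector_over_simps hinner_add_left hinner_scale_left)
qed (use x in simp)

lemma greedy_family_images_orthogonal:
  assumes W: "matrix_over \<FF> W" and g: "greedy_family \<FF> W p v" and "i < p" "j < p" "i \<noteq> j"
  shows "hinner (W *v v i) (W *v v j) = 0"
proof -
  have lt: "hinner (W *v v b) (W *v v a) = 0" if "a < b" "b < p" for a b
    using that g by (intro greedy_family_image_orthogonal[OF W g])
      (auto simp: greedy_familyD greedy_family_orthonormal[OF g])
  show ?thesis
    using lt[of i j] lt[of j i] assms hinner_commute[of "W *v v i" "W *v v j"]
    by (cases i j rule: linorder_cases) auto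
qed

lemma greedy_family_extend:
  fixes W :: "complex^'n^'m"
  assumes g: "greedy_family \<FF> W p v"
    and x: "vector_over \<FF> x" "\<And>j. j < p \<Longrightarrow> hinner x (v j) = 0" "W *v x \<noteq> 0"
  shows "\<exists>w. greedy_family \<FF> W (Suc p) (v(p := w))"
proof -
  define K where "K = {y. vector_over \<FF> y \<and> (\<forall>j<p. hinner y (v j) = 0) \<and> norm y = 1}"
  have unit: "complex_of_real (inverse (norm y)) *s y \<in> K"
    if "vector_over \<FF> y" "\<And>j. j < p \<Longrightarrow> hinner y (v j) = 0" "y \<noteq> 0" for y
    using that by (auto simp: K_def hinner_scale_left norm_scale_vec norm_inverse
        simp del: of_real_inverse intro!: vector_over_scale scalars_of_real)
  have "x \<noteq> 0" using x(3) by auto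
  then have "K \<noteq> {}" using unit[OF x(1,2)] by auto
  moreover have "compact K"
  proof -
    have "closed {y :: complex^'n. \<forall>i. y $ i \<in> scalars \<FF>}"
      by (intro closed_Collect_all closed_vimage_Int[of "scalars \<FF>", unfolded vimage_def] 
          closed_scalars continuous_closed_vimage[unfolded vimage_def] isCont_vec_nth continuous_ident)
    moreover have "closed {y. \<forall>j<p. hinner y (v j) = 0}"
      unfolding hinner_def
      by (intro closed_Collect_all closed_Collect_imp open_Collect_const closed_Collect_eq continuous_intros)
    moreover have "closed {y :: complex^'n. norm y = 1}"
      by (intro closed_Collect_eq continuous_intros)
    ultimately have "closed K"
      unfolding K_def vector_over_def by (intro closed_Collect_conj)
    moreover have "bounded K" by (auto simp: K_def bounded_iff intro: exI[of _ 1])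
    ultimately show ?thesis by (simp add: compact_eq_bounded_closed)
  qed
  moreover have "continuous_on K (\<lambda>y. norm (W *v y))"
    by (intro continuous_intros linear_continuous_on bounded_linear_complex_matrix)
  ultimately obtain w where w: "w \<in> K" "\<And>y. y \<in> K \<Longrightarrow> norm (W *v y) \<le> norm (W *v w)"
    using continuous_attains_sup[of K "\<lambda>y. norm (W *v y)"] by auto
  have max: "norm (W *v y) \<le> norm (W *v w) * norm y"
    if "vector_over \<FF> y" "\<And>j. j < p \<Longrightarrow> hinner y (v j) = 0" for y
  proof (cases "y = 0")
    case False
    have "norm (W *v (complex_of_real (inverse (norm y)) *s y)) \<le> norm (W *v w)"
      by (intro w unit that False)
    then show ?thesis
      using False unfolding vector_scalar_commute norm_scale_vec norm_of_real
      by (simp add: field_simps)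
  qed simp
  have "W *v w \<noteq> 0"
    using max[OF x(1,2)] x(3) by auto
  then have "greedy_family \<FF> W (Suc p) (v(p := w))"
    using g w(1) max unfolding greedy_family_def K_def
    by (auto simp: less_Suc_eq)
  then show ?thesis ..
qed

text \<open>
  The singular vectors are eigenvectors of \<open>W\<^sup>* W\<close>. This places their conjugates in the row space
  of \<open>W\<close>, whose dimension is the rank.
\<close>

lemma greedy_family_eigenvector:
  assumes W: "matrix_over \<FF> W" and g: "greedy_family \<FF> W p v" and i: "i < p"
  shows "conj_transpose W *v (W *v v i) = hinner (W *v v i) (W *v v i) *s v i"
proof -
  define y where "y = conj_transpose W *v (W *v v i)"
  define x where "x = y - hinner y (v i) *s v i"
  have y: "hinner y z = hinner (W *v v i) (W *v z)" for z
    by (simp add: y_def hinner_matrix_left)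
  have vi: "vector_over \<FF> (v i)" "norm (v i) = 1"
    using greedy_familyD[OF g i] by auto
  have oy: "vector_over \<FF> y"
    unfolding y_def by (intro vector_over_matrix matrix_over_conj_transpose W vi)
  have ox: "vector_over \<FF> x"
    unfolding x_def by (intro vector_over_diff vector_over_scale hinner_in_scalars oy vi)
  have orth: "hinner x (v j) = 0" if "j \<le> i" for j
  proof (cases "j = i")
    case False
    then show ?thesis
      using that i greedy_family_images_orthogonal[OF W g, of i j] greedy_family_orthonormal[OF g, of i j]
      by (simp add: x_def hinner_diff_left hinner_scale_left y)
  qed (simp add: x_def hinner_diff_left hinner_scale_left hinner_self vi)
  have "hinner y x = 0"
    using greedy_family_image_orthogonal[OF W g i ox orth]
    by (subst y, subst hinner_commute) simp
  moreover have "hinner (v i) x = 0"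
    using orth[of i] by (subst hinner_commute) simp
  ultimately have "hinner x x = 0"
    by (subst (1) x_def) (simp add: hinner_diff_left hinner_scale_left)
  then have "x = 0" by (simp add: hinner_self)
  then show ?thesis by (simp add: x_def y y_def[symmetric])
qed

lemma independent_orthonormal:
  assumes "finite B" "\<And>a b. a \<in> B \<Longrightarrow> b \<in> B \<Longrightarrow> hinner a b = (if a = b then 1 else 0)"
  shows "vec.independent B"
proof (rule vec.independent_if_scalars_zero[OF assms(1)])
  fix f x
  assume f: "(\<Sum>b\<in>B. f b *s b) = 0" and x: "x \<in> B"
  have "0 = hinner (\<Sum>b\<in>B. f b *s b) x" by (simp add: f hinner_def)
  also have "\<dots> = (\<Sum>b\<in>B. if b = x then f b else 0)"
    unfolding hinner_sum_left by (intro sum.cong) (simp_all add: hinner_scale_left assms x)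
  also have "\<dots> = f x" using assms(1) x by simp
  finally show "f x = 0" by simp
qed

definition cnj_vec :: "complex^'n \<Rightarrow> complex^'n" where
  "cnj_vec x = (\<chi> i. cnj (x $ i))"

lemma hinner_cnj_vec: "hinner (cnj_vec x) (cnj_vec y) = cnj (hinner x y)"
  by (simp add: hinner_def cnj_vec_def)

lemma greedy_family_conjugates:
  assumes g: "greedy_family \<FF> W p v"
  shows "inj_on (\<lambda>i. cnj_vec (v i)) {..<p}" "vec.independent ((\<lambda>i. cnj_vec (v i)) ` {..<p})"
proof -
  have on: "hinner (cnj_vec (v i)) (cnj_vec (v j)) = (if i = j then 1 else 0)" if "i < p" "j < p" for i j
    using that by (simp add: hinner_cnj_vec greedy_family_orthonormal[OF g])
  show inj: "inj_on (\<lambda>i. cnj_vec (v i)) {..<p}"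
  proof (rule inj_onI)
    fix i j assume "i \<in> {..<p}" "j \<in> {..<p}" "cnj_vec (v i) = cnj_vec (v j)"
    then show "i = j" using on[of i i] on[of i j] by (auto split: if_splits)
  qed
  show "vec.independent ((\<lambda>i. cnj_vec (v i)) ` {..<p})"
    by (rule independent_orthonormal) (use on in \<open>auto simp: inj_on_eq_iff[OF inj]\<close>)
qed

lemma greedy_family_le_rank:
  fixes W :: "complex^'n^'m"
  assumes W: "matrix_over \<FF> W" and g: "greedy_family \<FF> W p v"
  shows "p \<le> rank W"
proof -
  let ?B = "(\<lambda>i. cnj_vec (v i)) ` {..<p}"
  have "cnj_vec (v i) \<in> vec.span (rows W)" if i: "i < p" for i
  proof -
    define c where "c = hinner (W *v v i) (W *v v i)"
    have c: "c \<noteq> 0" using greedy_familyD(3)[OF g i] by (simp add: c_def hinner_self)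
    have "cnj_vec (conj_transpose W *v (W *v v i)) = (\<Sum>k\<in>UNIV. cnj ((W *v v i) $ k) *s row k W)"
      by (simp add: vec_eq_iff cnj_vec_def conj_transpose_def row_def mult.commute
          matrix_vector_mult_def[of "\<chi> i j. cnj (W $ j $ i)"])
    also have "\<dots> \<in> vec.span (rows W)"
      by (intro vec.span_sum vec.span_scale vec.span_base) (auto simp: rows_def)
    also have "cnj_vec (conj_transpose W *v (W *v v i)) = cnj c *s cnj_vec (v i)"
      unfolding greedy_family_eigenvector[OF W g i] c_def by (simp add: vec_eq_iff cnj_vec_def)
    finally have "inverse (cnj c) *s (cnj c *s cnj_vec (v i)) \<in> vec.span (rows W)"
      by (rule vec.span_scale)
    then show ?thesis using c by (simp add: vec.scale_scale)
  qed
  then have "card ?B \<le> vec.dim (vec.span (rows W))"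
    using greedy_family_conjugates(2)[OF g] by (intro vec.independent_card_le_dim) auto
  then show ?thesis
    by (simp add: card_image[OF greedy_family_conjugates(1)[OF g]] row_rank_def_gen vec.dim_span)
qed

text \<open>
  A family of maximal length exhausts \<open>W\<close>: on the orthogonal complement of its members \<open>W\<close>
  vanishes, since otherwise it could be extended.
\<close>

lemma maximal_greedy_family:
  fixes W :: "complex^'n^'m"
  assumes W: "matrix_over \<FF> W"
  obtains v where "greedy_family \<FF> W (rank W) v"
    "\<And>k j. W $ k $ j = (\<Sum>i<rank W. (W *v v i) $ k * cnj (v i $ j))"
proof -
  define p where "p = (GREATEST p. \<exists>v. greedy_family \<FF> W p v)"
  have ex: "\<exists>v. greedy_family \<FF> W 0 v" by (simp add: greedy_family_def)
  have bound: "q \<le> rank W" if "\<exists>w. greedy_family \<FF> W q w" for q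
    using that greedy_family_le_rank[OF W] by blast
  obtain v where g: "greedy_family \<FF> W p v"
    using GreatestI_nat[of "\<lambda>q. \<exists>w. greedy_family \<FF> W q w", OF ex bound] by (auto simp: p_def)
  have maximal: "q \<le> p" if "greedy_family \<FF> W q w" for q w
    unfolding p_def by (rule Greatest_le_nat[where b = "rank W"]) (use that bound in blast)+
  have expand: "W *v x = (\<Sum>i<p. hinner x (v i) *s (W *v v i))" if x: "vector_over \<FF> x" for x
  proof (rule ccontr)
    let ?y = "x - (\<Sum>i<p. hinner x (v i) *s v i)"
    assume neq: "W *v x \<noteq> (\<Sum>i<p. hinner x (v i) *s (W *v v i))"
    have "W *v (\<Sum>i<p. hinner x (v i) *s v i) = (\<Sum>i<p. hinner x (v i) *s (W *v v i))"
      by (simp add: vec.linear_sum[OF matrix_vector_mul_linear_gen] vector_scalar_commute)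
    then have "W *v ?y \<noteq> 0"
      using neq by (simp add: matrix_vector_mult_diff_distrib)
    moreover have "vector_over \<FF> ?y"
      using greedy_familyD(1)[OF g] x
      by (intro vector_over_diff vector_over_sum vector_over_scale hinner_in_scalars) auto
    moreover have "hinner ?y (v j) = 0" if "j < p" for j
    proof -
      have "(\<Sum>i<p. hinner x (v i) * hinner (v i) (v j)) = (\<Sum>i<p. if i = j then hinner x (v j) else 0)"
        using that by (intro sum.cong) (auto simp: greedy_family_orthonormal[OF g])
      then show ?thesis
        using that by (simp add: hinner_diff_left hinner_sum_left hinner_scale_left)
    qed
    ultimately obtain w where "greedy_family \<FF> W (Suc p) (v(p := w))"
      using greedy_family_extend[OF g] by blast
    then show False using maximal[of "Suc p"] by simp
  qed
  have entries: "W $ k $ j = (\<Sum>i<p. (W *v v i) $ k * cnj (v i $ j))" for k j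
  proof -
    have "W $ k $ j = (W *v axis j 1) $ k"
      by (simp add: matrix_vector_mult_def axis_def if_distrib[of "\<lambda>t. _ * t"] cong: if_cong)
    also have "\<dots> = (\<Sum>i<p. (W *v v i) $ k * cnj (v i $ j))"
      by (subst expand[OF vector_over_axis]) (simp add: hinner_axis mult.commute)
    finally show ?thesis .
  qed
  have "row k W = (\<Sum>i<p. (W *v v i) $ k *s cnj_vec (v i))" for k
    by (simp add: vec_eq_iff row_def entries cnj_vec_def)
  moreover have "(\<Sum>i<p. (W *v v i) $ k *s cnj_vec (v i)) \<in> vec.span ((\<lambda>i. cnj_vec (v i)) ` {..<p})" for k
    by (rule vec.span_sum, rule vec.span_scale, rule vec.span_base) simp
  ultimately have "rows W \<subseteq> vec.span ((\<lambda>i. cnj_vec (v i)) ` {..<p})"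
    by (auto simp: rows_def)
  then have "rank W \<le> card ((\<lambda>i. cnj_vec (v i)) ` {..<p})"
    unfolding row_rank_def_gen by (rule vec.dim_le_card) simp
  also have "\<dots> \<le> p" using card_image_le[of "{..<p}"] by simp
  finally have "p = rank W" using greedy_family_le_rank[OF W g] by simp
  then show ?thesis using that g entries by blast
qed

lemma diagonal_matrix_mult_right: "(A ** diagonal_matrix \<sigma>) $ i $ j = A $ i $ j * complex_of_real (\<sigma> j)"
proof -
  have "A $ i $ k * diagonal_matrix \<sigma> $ k $ j = (if k = j then A $ i $ j * complex_of_real (\<sigma> j) else 0)" for k
    by (simp add: diagonal_matrix_def)
  then show ?thesis by (simp add: matrix_matrix_mult_def)
qed

text \<open>
  The columns of \<open>V\<close> are a maximal greedy family and those of \<open>U\<close> its normalised images. The family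
  has length \<open>CARD('r)\<close> and is indexed by \<open>nat\<close>; the order isomorphism \<open>e\<close>, counting predecessors,
  makes it a family over \<open>'r\<close> and keeps the singular values decreasing.
\<close>

lemma thin_singular_value_decomposition:
  fixes W :: "complex^'n^'m"
  assumes W: "matrix_over \<FF> W" and r: "rank W = CARD('r::{finite,linorder})"
  obtains U :: "complex^('r::{finite,linorder})^'m" and V :: "complex^('r::{finite,linorder})^'n" and \<sigma> :: "'r \<Rightarrow> real"
  where "matrix_over \<FF> U" "matrix_over \<FF> V"
    "conj_transpose U ** U = mat 1" "conj_transpose V ** V = mat 1"
    "antimono \<sigma>" "\<And>i. \<sigma> i > 0"
    "W = U ** diagonal_matrix \<sigma> ** conj_transpose V"
proof -
  obtain v where g: "greedy_family \<FF> W (rank W) v"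
    and entries: "\<And>k j. W $ k $ j = (\<Sum>i<rank W. (W *v v i) $ k * cnj (v i $ j))"
    using maximal_greedy_family[OF W] by blast
  define e :: "'r \<Rightarrow> nat" where "e a = card {..<a}" for a
  have e_less: "e a < e b" if "a < b" for a b
    unfolding e_def using that by (intro psubset_card_mono) auto
  have inj: "inj e"
    by (rule injI) (metis e_less less_irrefl linorder_less_linear)
  have "e a < rank W" for a
  proof -
    have "e a < card (UNIV :: 'r set)"
      unfolding e_def by (intro psubset_card_mono) auto
    then show ?thesis by (simp add: r)
  qed
  then have "range e \<subseteq> {..<rank W}" by auto
  then have range_e: "range e = {..<rank W}"
    by (intro card_subset_eq) (simp_all add: card_image[OF inj] r)
  have e: "e a < rank W" for a using range_e by auto
  define \<sigma> where "\<sigma> a = norm (W *v v (e a))" for a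
  define U :: "complex^('r::{finite,linorder})^'m" where "U = (\<chi> k a. (W *v v (e a)) $ k / complex_of_real (\<sigma> a))"
  define V :: "complex^('r::{finite,linorder})^'n" where "V = (\<chi> k a. v (e a) $ k)"
  have \<sigma>: "\<sigma> a > 0" for a
    using greedy_familyD(3)[OF g e] by (simp add: \<sigma>_def)
  have "matrix_over \<FF> V"
    using greedy_familyD(1)[OF g e] by (simp add: V_def matrix_over_def vector_over_def)
  moreover have "matrix_over \<FF> U"
    using vector_over_matrix[OF W greedy_familyD(1)[OF g e]]
    by (simp add: U_def matrix_over_def vector_over_def scalars_divide scalars_of_real)
  moreover have "conj_transpose V ** V = mat 1"
  proof -
    have "(conj_transpose V ** V) $ a $ b = hinner (v (e b)) (v (e a))" for a b
      by (simp add: matrix_matrix_mult_def conj_transpose_def V_def hinner_def mult.commute)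
    then show ?thesis
      by (auto simp: vec_eq_iff mat_def greedy_family_orthonormal[OF g e e] inj_eq[OF inj])
  qed
  moreover have "conj_transpose U ** U = mat 1"
  proof -
    have "(conj_transpose U ** U) $ a $ b
        = hinner (W *v v (e b)) (W *v v (e a)) / (complex_of_real (\<sigma> a) * complex_of_real (\<sigma> b))" for a b
      by (simp add: matrix_matrix_mult_def conj_transpose_def U_def hinner_def mult.commute
          sum_divide_distrib)
    moreover have "hinner (W *v v (e b)) (W *v v (e a)) = (if a = b then complex_of_real ((\<sigma> a)\<^sup>2) else 0)" for a b
      using greedy_family_images_orthogonal[OF W g e e, of b a]
      by (auto simp: inj_eq[OF inj] hinner_self \<sigma>_def)
    ultimately show ?thesis
      using \<sigma> by (simp add: vec_eq_iff mat_def power2_eq_square less_imp_neq[symmetric])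
  qed
  moreover have "antimono \<sigma>"
  proof (rule antimonoI)
    fix a b :: 'r assume "a \<le> b"
    then have ab: "e a \<le> e b" using e_less[of a b] by (cases "a = b") (simp_all add: less_imp_le)
    have "norm (W *v v (e b)) \<le> norm (W *v v (e a)) * norm (v (e b))"
      using ab by (intro greedy_familyD(5)[OF g e] greedy_familyD(1)[OF g e] greedy_familyD(4)[OF g e]) auto
    then show "\<sigma> b \<le> \<sigma> a" by (simp add: \<sigma>_def greedy_familyD(2)[OF g e])
  qed
  moreover have "W = U ** diagonal_matrix \<sigma> ** conj_transpose V"
  proof -
    have "(U ** diagonal_matrix \<sigma> ** conj_transpose V) $ k $ j = W $ k $ j" for k j
    proof -
      have "(U ** diagonal_matrix \<sigma> ** conj_transpose V) $ k $ j
          = (\<Sum>a\<in>UNIV. (U ** diagonal_matrix \<sigma>) $ k $ a * conj_transpose V $ a $ j)"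
        by (simp add: matrix_matrix_mult_def)
      also have "\<dots> = (\<Sum>a\<in>UNIV. (W *v v (e a)) $ k * cnj (v (e a) $ j))"
        using \<sigma> by (simp add: diagonal_matrix_mult_right conj_transpose_def U_def V_def less_imp_neq[symmetric])
      also have "\<dots> = (\<Sum>i\<in>range e. (W *v v i) $ k * cnj (v i $ j))"
        by (simp add: sum.reindex[OF inj])
      finally show ?thesis by (simp add: range_e entries)
    qed
    then show ?thesis by (simp add: vec_eq_iff)
  qed
  ultimately show ?thesis using that \<sigma> by blast
qed

section \<open>Rotation invariance of isotropic normal laws\<close>

lemma borel_measurable_linear:
  fixes f :: "'a::euclidean_space \<Rightarrow> 'b::euclidean_space"
  shows "linear f \<Longrightarrow> f \<in> borel_measurable borel"
  by (intro borel_measurable_continuous_onI linear_continuous_on) (simp add: linear_conv_bounded_linear)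

lemma nn_integral_lborel_translate:
  fixes c :: "'a::euclidean_space"
  assumes [measurable]: "f \<in> borel_measurable borel"
  shows "(\<integral>\<^sup>+x. f (c + x) \<partial>lborel) = (\<integral>\<^sup>+x. f x \<partial>lborel)"
proof -
  have "(\<integral>\<^sup>+x. f x \<partial>lborel) = (\<integral>\<^sup>+x. f x \<partial>distr lborel borel ((+) c))"
    by (simp add: lborel_distr_plus)
  also have "\<dots> = (\<integral>\<^sup>+x. f (c + x) \<partial>lborel)"
    by (simp add: nn_integral_distr)
  finally show ?thesis ..
qed

text \<open>
  Uniqueness of translation-invariant measures, in the form of Fubini's theorem: with \<open>B\<close> the unit
  ball, the double integral of \<open>indicator A (x + T y) * indicator B y\<close> is \<open>\<lambda>(A) \<lambda>(B)\<close> when \<open>x\<close> is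
  integrated first. Substituting \<open>y - T x\<close> for \<open>y\<close> decouples the factors the other way round and
  gives \<open>\<lambda>(T\<^sup>-\<^sup>1 A) \<lambda>(B)\<close>: the shift by \<open>x\<close> cancels since \<open>T (T x) = x\<close>, and \<open>T\<close> preserves the ball.
\<close>

lemma lborel_distr_involutive_isometry:
  fixes T :: "'a::euclidean_space \<Rightarrow> 'a"
  assumes T: "linear T" "\<And>x. norm (T x) = norm x" "\<And>x. T (T x) = x"
  shows "distr lborel borel T = lborel"
proof (rule measure_eqI)
  have meas[measurable]: "T \<in> borel_measurable borel"
    by (rule borel_measurable_linear[OF T(1)])
  fix A :: "'a set"
  assume "A \<in> sets (distr lborel borel T)"
  then have A[measurable]: "A \<in> sets borel" by simp
  define B :: "'a set" where "B = ball 0 1"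
  have B[measurable]: "B \<in> sets borel" by (simp add: B_def)
  have Tm: "T (a + b) = T a + T b" "T (a - b) = T a - T b" for a b
    using T(1) by (simp_all add: linear_add linear_diff)
  let ?I = "\<integral>\<^sup>+x. \<integral>\<^sup>+y. indicator A (x + T y) * indicator B y \<partial>lborel \<partial>lborel"
  have "?I = (\<integral>\<^sup>+y. \<integral>\<^sup>+x. indicator A (T y + x) * indicator B y \<partial>lborel \<partial>lborel)"
    by (subst lborel_pair.Fubini') (simp_all add: add.commute)
  also have "\<dots> = (\<integral>\<^sup>+y. emeasure lborel A * indicator B y \<partial>lborel)"
    by (intro nn_integral_cong)
       (simp add: nn_integral_multc nn_integral_lborel_translate[of "indicator A"])
  also have "\<dots> = emeasure lborel A * emeasure lborel B"
    by (simp add: nn_integral_cmult)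
  finally have I1: "?I = emeasure lborel A * emeasure lborel B" .
  have "?I = (\<integral>\<^sup>+x. \<integral>\<^sup>+z. indicator A (T z) * indicator B (- T x + z) \<partial>lborel \<partial>lborel)"
  proof (rule nn_integral_cong)
    fix x
    have "(\<integral>\<^sup>+y. indicator A (x + T y) * indicator B y \<partial>lborel)
        = (\<integral>\<^sup>+z. indicator A (x + T (- T x + z)) * indicator B (- T x + z) \<partial>lborel :: ennreal)"
      by (rule nn_integral_lborel_translate[symmetric]) measurable
    then show "(\<integral>\<^sup>+y. indicator A (x + T y) * indicator B y \<partial>lborel)
        = (\<integral>\<^sup>+z. indicator A (T z) * indicator B (- T x + z) \<partial>lborel :: ennreal)"
      by (simp add: Tm T)
  qed
  also have "\<dots> = (\<integral>\<^sup>+z. \<integral>\<^sup>+x. indicator A (T z) * indicator B (- T x + z) \<partial>lborel \<partial>lborel)"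
    by (rule lborel_pair.Fubini') measurable
  also have "\<dots> = (\<integral>\<^sup>+z. indicator A (T z) * emeasure lborel B \<partial>lborel)"
  proof (rule nn_integral_cong)
    fix z
    have "norm (z - T x) = norm (T z - x)" for x
      using T(2)[of "z - T x"] by (simp add: Tm T)
    then have "norm (T x - z) = norm (T z - x)" for x
      by (metis norm_minus_commute)
    then have "indicator B (- T x + z) = (indicator (ball (T z) 1) x :: ennreal)" for x
      by (auto simp: B_def dist_norm split: split_indicator)
    then have "(\<integral>\<^sup>+x. indicator A (T z) * indicator B (- T x + z) \<partial>lborel)
        = indicator A (T z) * emeasure lborel (ball (T z) 1)"
      by (simp only:) (subst nn_integral_cmult, simp_all add: borel_measurable_indicator)
    also have "emeasure lborel (ball (T z) 1) = emeasure lborel B"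
      by (simp add: B_def emeasure_ball)
    finally show "(\<integral>\<^sup>+x. indicator A (T z) * indicator B (- T x + z) \<partial>lborel)
        = indicator A (T z) * emeasure lborel B" .
  qed
  also have "\<dots> = (\<integral>\<^sup>+x. indicator A x \<partial>distr lborel borel T) * emeasure lborel B"
    by (subst nn_integral_distr) (simp_all add: nn_integral_multc)
  also have "\<dots> = emeasure (distr lborel borel T) A * emeasure lborel B"
    by simp
  finally have "emeasure (distr lborel borel T) A * emeasure lborel B
      = emeasure lborel A * emeasure lborel B"
    using I1 by simp
  moreover have "emeasure lborel B \<noteq> 0" "emeasure lborel B \<noteq> \<infinity>"
    using unit_ball_vol_pos[of "real DIM('a)"]
    by (simp_all add: B_def emeasure_ball less_imp_neq[symmetric])
  ultimately show "emeasure (distr lborel borel T) A = emeasure lborel A"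
    by (simp add: mult.commute[of _ "emeasure lborel B"] ennreal_mult_cancel_left)
qed simp

text \<open>
  The law of a vector whose coordinates are independent centred normal variables of variance
  \<open>1 / (2 * s)\<close>. Real standard Gaussians have \<open>s = 1 / 2\<close>, complex ones \<open>s = 1\<close>.
\<close>

definition isotropic_density :: "real \<Rightarrow> 'a::euclidean_space \<Rightarrow> ennreal" where
  "isotropic_density s x = ennreal (sqrt (s / pi) ^ DIM('a) * exp (- s * (norm x)\<^sup>2))"

definition isotropic_normal :: "real \<Rightarrow> 'a::euclidean_space measure" where
  "isotropic_normal s = density lborel (isotropic_density s)"

lemma isotropic_density_measurable [measurable]: "isotropic_density s \<in> borel_measurable borel"
  unfolding isotropic_density_def by measurable

lemma sets_isotropic_normal [simp, measurable_cong]: "sets (isotropic_normal s) = sets borel"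
  by (simp add: isotropic_normal_def)

lemma space_isotropic_normal [simp]: "space (isotropic_normal s) = UNIV"
  by (simp add: isotropic_normal_def)

lemma isotropic_density_prod:
  assumes "s > 0"
  shows "isotropic_density s (x :: 'a::euclidean_space) = (\<Prod>b\<in>Basis. isotropic_density s (x \<bullet> b))"
proof -
  have "(norm x)\<^sup>2 = (\<Sum>b\<in>Basis. (x \<bullet> b)\<^sup>2)"
    unfolding power2_norm_eq_inner euclidean_inner[of x x] by (simp add: power2_eq_square)
  then have "exp (- s * (norm x)\<^sup>2) = (\<Prod>b\<in>Basis. exp (- s * (x \<bullet> b)\<^sup>2))"
    by (simp add: sum_distrib_left exp_sum flip: sum_negf)
  then show ?thesis
    using assms by (simp add: isotropic_density_def prod.distrib prod_ennreal)
qed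

lemma prob_space_isotropic_normal:
  assumes s: "s > 0"
  shows "prob_space (isotropic_normal s :: 'a::euclidean_space measure)"
proof
  define \<sigma> where "\<sigma> = 1 / sqrt (2 * s)"
  have \<sigma>: "\<sigma> > 0" "\<sigma>\<^sup>2 = 1 / (2 * s)" using s by (simp_all add: \<sigma>_def power_divide)
  have "isotropic_density s = (\<lambda>x :: real. ennreal (normal_density 0 \<sigma> x))"
    using s by (simp add: fun_eq_iff isotropic_density_def normal_density_def \<sigma> real_sqrt_divide)
  then have "(\<integral>\<^sup>+x. isotropic_density s (x::real) \<partial>lborel) = emeasure (density lborel (normal_density 0 \<sigma>)) (UNIV :: real set)"
    by (simp add: emeasure_density)
  also have "\<dots> = 1"
    using prob_space.emeasure_space_1[OF prob_space_normal_density[OF \<sigma>(1), of 0]] by simp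
  finally have one: "(\<integral>\<^sup>+x. isotropic_density s (x::real) \<partial>lborel) = (1 :: ennreal)" .
  have "emeasure (isotropic_normal s) (space (isotropic_normal s :: 'a measure))
      = (\<integral>\<^sup>+x. isotropic_density s (x::'a) \<partial>lborel)"
    by (simp add: isotropic_normal_def emeasure_density)
  also have "\<dots> = (\<Prod>b\<in>(Basis :: 'a set). \<integral>\<^sup>+x. isotropic_density s (x::real) \<partial>lborel)"
    unfolding isotropic_density_prod[OF s, where 'a='a]
    by (rule nn_integral_lborel_prod) simp_all
  finally show "emeasure (isotropic_normal s) (space (isotropic_normal s :: 'a measure)) = 1"
    by (simp add: one)
qed

lemma isotropic_normal_prod:
  assumes s: "s > 0"
  shows "isotropic_normal s \<Otimes>\<^sub>M isotropic_normal s
    = (isotropic_normal s :: ('a::euclidean_space \<times> 'b::euclidean_space) measure)"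
proof -
  interpret B: prob_space "isotropic_normal s :: 'b measure"
    by (rule prob_space_isotropic_normal[OF s])
  have d: "isotropic_density s x * isotropic_density s y = isotropic_density s (x, y)" for x :: 'a and y :: 'b
  proof -
    have "(norm (x, y))\<^sup>2 = (norm x)\<^sup>2 + (norm y)\<^sup>2" by (simp add: norm_Pair)
    then show ?thesis
      using s by (simp add: isotropic_density_def power_add exp_add[symmetric] algebra_simps
          flip: ennreal_mult)
  qed
  have "isotropic_normal s \<Otimes>\<^sub>M isotropic_normal s
      = density (lborel \<Otimes>\<^sub>M lborel) (\<lambda>(x::'a, y::'b). isotropic_density s x * isotropic_density s y)"
    unfolding isotropic_normal_def
    by (rule pair_measure_density)
       (use B.sigma_finite_measure_axioms in \<open>simp_all add: isotropic_normal_def lborel.sigma_finite_measure_axioms\<close>)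
  then show ?thesis
    by (simp add: lborel_prod d isotropic_normal_def case_prod_beta')
qed

text \<open>
  A coisometry \<open>P\<close> with right inverse \<open>S = P\<^sup>*\<close> maps an isotropic normal vector to one of smaller
  dimension. To reduce this to a bijection, adjoin an independent normal vector \<open>y\<close>: the map
  \<open>(x, y) \<mapsto> (x - S (P x) + S y, P x)\<close> exchanges the component \<open>P x\<close> of \<open>x\<close> with \<open>y\<close>, so it is an
  isometric involution of the product space, and \<open>P x\<close> is the second component of its value.
\<close>

lemma isotropic_normal_coisometry:
  fixes P :: "'a::euclidean_space \<Rightarrow> 'b::euclidean_space"
  assumes s: "s > 0" and P: "linear P" and S: "linear S"
    and PS: "\<And>y. P (S y) = y" and adj: "\<And>x y. P x \<bullet> y = x \<bullet> S y"
  shows "distr (isotropic_normal s) borel P = isotropic_normal s"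
proof -
  define T where "T = (\<lambda>(x, y). (x - S (P x) + S y, P x))"
  have [measurable]: "P \<in> borel_measurable borel" by (rule borel_measurable_linear[OF P])
  note lin = linear_add[OF P] linear_diff[OF P] linear_scale[OF P]
    linear_add[OF S] linear_diff[OF S] linear_scale[OF S]
  have T_lin: "linear T"
    by (rule linearI) (auto simp: T_def lin scaleR_diff_right scaleR_add_right)
  have T_inv: "T (T z) = z" for z
    by (cases z) (simp add: T_def lin PS)
  have T_norm: "norm (T z) = norm z" for z
  proof -
    obtain x y where z: "z = (x, y)" by fastforce
    have "x \<bullet> S (P x) = P x \<bullet> P x" "S (P x) \<bullet> x = P x \<bullet> P x" "S (P x) \<bullet> S (P x) = P x \<bullet> P x"
      "x \<bullet> S y = P x \<bullet> y" "S y \<bullet> x = P x \<bullet> y" "S (P x) \<bullet> S y = P x \<bullet> y" "S y \<bullet> S (P x) = P x \<bullet> y"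
      "S y \<bullet> S y = y \<bullet> y"
      using adj[of x "P x"] adj[of "S (P x)" "P x"] adj[of x y] adj[of "S (P x)" y] adj[of "S y" y]
      by (simp_all add: PS inner_commute)
    then have "T z \<bullet> T z = z \<bullet> z"
      by (simp add: z T_def inner_add_left inner_add_right inner_diff_left inner_diff_right)
    then show ?thesis by (simp add: norm_eq_sqrt_inner)
  qed
  have [measurable]: "T \<in> borel_measurable borel" by (rule borel_measurable_linear[OF T_lin])
  let ?N = "isotropic_normal s :: ('a \<times> 'b) measure"
  have "distr ?N borel T = density (distr lborel borel T) (isotropic_density s)"
  proof -
    have "isotropic_density s (T z) = isotropic_density s z" for z
      by (simp add: isotropic_density_def T_norm)
    then show ?thesis
      by (simp add: density_distr isotropic_normal_def)
  qed
  then have T: "distr ?N borel T = ?N"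
    unfolding isotropic_normal_def
    by (simp add: lborel_distr_involutive_isometry[OF T_lin T_norm T_inv])
  have [measurable]: "fst \<in> borel_measurable (borel :: ('a \<times> 'b) measure)"
    "snd \<in> borel_measurable (borel :: ('a \<times> 'b) measure)"
    by (auto intro!: borel_measurable_continuous_onI continuous_intros)
  interpret A: prob_space "isotropic_normal s :: 'a measure"
    by (rule prob_space_isotropic_normal[OF s])
  interpret B: prob_space "isotropic_normal s :: 'b measure"
    by (rule prob_space_isotropic_normal[OF s])
  have fst: "distr ?N borel fst = isotropic_normal s"
  proof -
    have "distr ?N (isotropic_normal s) fst = isotropic_normal s"
      unfolding isotropic_normal_prod[OF s, symmetric] by (rule B.distr_pair_fst)
    then show ?thesis by (simp cong: distr_cong)
  qed
  have snd: "distr ?N borel snd = isotropic_normal s"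
  proof -
    interpret pair_sigma_finite "isotropic_normal s :: 'b measure" "isotropic_normal s :: 'a measure" ..
    have "distr ?N (isotropic_normal s) snd = isotropic_normal s"
      unfolding isotropic_normal_prod[OF s, symmetric]
      by (subst pair_sigma_finite.distr_pair_swap) (unfold_locales, simp add: distr_distr comp_def case_prod_beta' A.distr_pair_fst)
    then show ?thesis by (simp cong: distr_cong)
  qed
  have "distr (isotropic_normal s) borel P = distr (distr ?N borel fst) borel P"
    by (simp add: fst)
  also have "\<dots> = distr ?N borel (P \<circ> fst)"
    by (rule distr_distr) simp_all
  also have "P \<circ> fst = snd \<circ> T" by (auto simp: T_def)
  also have "distr ?N borel (snd \<circ> T) = distr (distr ?N borel T) borel snd"
    by (rule distr_distr[symmetric]) simp_all
  finally show ?thesis by (simp add: T snd)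
qed

section \<open>Gaussian matrices as isotropic normal vectors\<close>

lemma borel_measurable_vec_lambda [measurable (raw)]:
  fixes f :: "'c \<Rightarrow> 'n::finite \<Rightarrow> 'a::euclidean_space"
  assumes "\<And>i. (\<lambda>\<omega>. f \<omega> i) \<in> borel_measurable M"
  shows "(\<lambda>\<omega>. \<chi> i. f \<omega> i) \<in> borel_measurable M"
proof -
  have "(\<lambda>\<omega>. (\<chi> i. f \<omega> i) \<bullet> b) \<in> borel_measurable M" if "b \<in> Basis" for b :: "'a^'n"
  proof -
    obtain i u where b: "b = axis i u" "u \<in> Basis" using \<open>b \<in> Basis\<close> by (auto simp: Basis_vec_def)
    show ?thesis unfolding b inner_axis using assms by simp
  qed
  then show ?thesis by (rule borel_measurable_euclidean_space[THEN iffD2, rule_format])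
qed

lemma borel_measurable_vec_component [measurable (raw)]:
  fixes f :: "'c \<Rightarrow> 'a::euclidean_space^'n"
  assumes "f \<in> borel_measurable M"
  shows "(\<lambda>\<omega>. f \<omega> $ i) \<in> borel_measurable M"
  using assms by (rule borel_measurable_continuous_on[rotated]) (intro continuous_intros)

lemma lborel_vec:
  "lborel = distr (\<Pi>\<^sub>M i\<in>UNIV. lborel) borel (\<lambda>f. \<chi> i. f i :: 'a::euclidean_space^'n)"
proof (rule lborel_eqI)
  interpret product_sigma_finite "\<lambda>_::'n. lborel :: 'a measure" ..
  fix l u :: "'a^'n"
  assume le: "\<And>b. b \<in> Basis \<Longrightarrow> l \<bullet> b \<le> u \<bullet> b"
  have le': "l $ i \<bullet> b \<le> u $ i \<bullet> b" if "b \<in> Basis" for i b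
    using le[of "axis i b"] that by (auto simp: Basis_vec_def inner_axis)
  have "(\<lambda>f. \<chi> i. f i) -` box l u \<inter> space (\<Pi>\<^sub>M i\<in>(UNIV::'n set). lborel) = (\<Pi>\<^sub>E i\<in>UNIV. box (l $ i) (u $ i))"
    by (simp add: set_eq_iff mem_box Basis_vec_def inner_axis space_PiM PiE_iff)
  then have "emeasure (distr (\<Pi>\<^sub>M i\<in>UNIV. lborel) borel (\<lambda>f. \<chi> i. f i :: 'a^'n)) (box l u)
      = (\<Prod>i\<in>UNIV. emeasure lborel (box (l $ i) (u $ i)))"
    by (simp add: emeasure_distr emeasure_PiM)
  also have "\<dots> = (\<Prod>i\<in>UNIV. ennreal (\<Prod>b\<in>Basis. (u $ i - l $ i) \<bullet> b))"
    by (intro prod.cong refl emeasure_lborel_box le')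
  also have "\<dots> = ennreal (\<Prod>i\<in>UNIV. \<Prod>b\<in>Basis. (u $ i - l $ i) \<bullet> b)"
    by (intro prod_ennreal prod_nonneg) (simp add: le' inner_diff_left)
  also have "(\<Prod>i\<in>UNIV. \<Prod>b\<in>Basis. (u $ i - l $ i) \<bullet> b) = (\<Prod>z\<in>UNIV \<times> Basis. (u - l) \<bullet> axis (fst z) (snd z))"
    by (simp add: prod.cartesian_product case_prod_beta' inner_axis)
  also have "\<dots> = (\<Prod>b\<in>(\<lambda>z. axis (fst z) (snd z)) ` (UNIV \<times> Basis). (u - l) \<bullet> b)"
  proof (rule prod.reindex[symmetric, unfolded comp_def])
    show "inj_on (\<lambda>z. axis (fst z) (snd z) :: 'a^'n) (UNIV \<times> Basis)"
      by (auto simp: inj_on_def axis_eq_axis nonzero_Basis)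
  qed
  also have "(\<lambda>z. axis (fst z) (snd z)) ` (UNIV \<times> Basis) = (Basis :: ('a^'n) set)"
    by (simp add: Basis_vec_def set_eq_iff image_iff)
  finally show "emeasure (distr (\<Pi>\<^sub>M i\<in>UNIV. lborel) borel (\<lambda>f. \<chi> i. f i :: 'a^'n)) (box l u)
      = ennreal (\<Prod>b\<in>Basis. (u - l) \<bullet> b)" .
qed simp

lemma nn_integral_lborel_vec:
  fixes f :: "'n::finite \<Rightarrow> 'a::euclidean_space \<Rightarrow> ennreal"
  assumes [measurable]: "\<And>i. f i \<in> borel_measurable borel"
  shows "(\<integral>\<^sup>+x. (\<Prod>i\<in>UNIV. f i (x $ i)) \<partial>lborel) = (\<Prod>i\<in>UNIV. \<integral>\<^sup>+y. f i y \<partial>lborel)"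
proof -
  interpret product_sigma_finite "\<lambda>_::'n. lborel :: 'a measure" ..
  show ?thesis
    by (subst lborel_vec) (simp add: nn_integral_distr product_nn_integral_prod)
qed

lemma isotropic_density_vec:
  fixes x :: "'a::euclidean_space^'n"
  assumes "s > 0"
  shows "isotropic_density s x = (\<Prod>i\<in>UNIV. isotropic_density s (x $ i))"
proof -
  have "(norm x)\<^sup>2 = (\<Sum>i\<in>UNIV. (norm (x $ i))\<^sup>2)"
    by (simp add: norm_vec_def L2_set_def sum_nonneg)
  then have "exp (- s * (norm x)\<^sup>2) = (\<Prod>i\<in>UNIV. exp (- s * (norm (x $ i))\<^sup>2))"
    by (simp add: sum_distrib_left exp_sum flip: sum_negf)
  then show ?thesis
    using assms by (simp add: isotropic_density_def prod.distrib prod_ennreal power_mult mult.commute)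
qed

text \<open>
  Lebesgue measure and the isotropic density both factor over the entries of a matrix, hence so does
  the probability of a box with one side \<open>A (i, j)\<close> for each entry. This gives the marginals (all other
  sides \<open>UNIV\<close>) and independence.
\<close>

lemma isotropic_normal_entries_independent:
  assumes s: "s > 0"
  shows "prob_space.indep_vars (isotropic_normal s) (\<lambda>_. borel)
      (\<lambda>(i, j) X. X $ i $ j :: 'a::euclidean_space) (UNIV :: ('p::finite \<times> 'q::finite) set)"
    and "distr (isotropic_normal s) borel (\<lambda>X :: 'a^'q^'p. X $ i $ j) = isotropic_normal s"
proof -
  let ?N = "isotropic_normal s :: ('a^'q^'p) measure" and ?n = "isotropic_normal s :: 'a measure"
  interpret N: prob_space ?N by (rule prob_space_isotropic_normal[OF s])
  interpret n: prob_space ?n by (rule prob_space_isotropic_normal[OF s])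
  interpret P: product_sigma_finite "\<lambda>_::'p \<times> 'q. ?n" ..
  have box: "emeasure ?N {X. \<forall>i j. X $ i $ j \<in> A (i, j)} = (\<Prod>k\<in>UNIV. emeasure ?n (A k))"
    if A[measurable]: "\<And>k. A k \<in> sets borel" for A :: "'p \<times> 'q \<Rightarrow> 'a set"
  proof -
    let ?f = "\<lambda>i j y. isotropic_density s y * indicator (A (i, j)) y"
    have "indicator {X. \<forall>i j. X $ i $ j \<in> A (i, j)} X
        = (\<Prod>i\<in>UNIV. \<Prod>j\<in>UNIV. indicator (A (i, j)) (X $ i $ j) :: ennreal)" for X :: "'a^'q^'p"
      by (auto simp: indicator_def)
    then have "isotropic_density s X * indicator {X. \<forall>i j. X $ i $ j \<in> A (i, j)} X
        = (\<Prod>i\<in>UNIV. \<Prod>j\<in>UNIV. ?f i j (X $ i $ j))" for X :: "'a^'q^'p"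
      by (simp add: isotropic_density_vec[OF s] prod.distrib)
    moreover have "{X :: 'a^'q^'p. \<forall>i j. X $ i $ j \<in> A (i, j)} \<in> sets borel"
    proof -
      have "{X \<in> space borel. \<forall>i j. X $ i $ j \<in> A (i, j)} \<in> sets (borel :: ('a^'q^'p) measure)"
        by measurable
      then show ?thesis by simp
    qed
    ultimately have "emeasure ?N {X. \<forall>i j. X $ i $ j \<in> A (i, j)}
        = (\<integral>\<^sup>+X. (\<Prod>i\<in>UNIV. \<Prod>j\<in>UNIV. ?f i j (X $ i $ j)) \<partial>lborel)"
      by (simp add: isotropic_normal_def emeasure_density)
    also have "\<dots> = (\<Prod>i\<in>UNIV. \<integral>\<^sup>+Y. (\<Prod>j\<in>UNIV. ?f i j (Y $ j)) \<partial>lborel)"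
      by (rule nn_integral_lborel_vec[of "\<lambda>i Y. \<Prod>j\<in>UNIV. ?f i j (Y $ j)"]) measurable
    also have "\<dots> = (\<Prod>i\<in>UNIV. \<Prod>j\<in>UNIV. \<integral>\<^sup>+y. ?f i j y \<partial>lborel)"
      by (intro prod.cong refl nn_integral_lborel_vec) measurable
    also have "\<dots> = (\<Prod>k\<in>UNIV. emeasure ?n (A k))"
      by (simp add: isotropic_normal_def emeasure_density prod.cartesian_product case_prod_beta')
    finally show ?thesis .
  qed
  show marginal: "distr ?N borel (\<lambda>X. X $ i $ j) = ?n" for i j
  proof (rule measure_eqI)
    fix B assume "B \<in> sets (distr ?N borel (\<lambda>X. X $ i $ j))"
    then have B[measurable]: "B \<in> sets borel" by simp
    let ?A = "\<lambda>k. if k = (i, j) then B else UNIV"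
    have "emeasure (distr ?N borel (\<lambda>X. X $ i $ j)) B = emeasure ?N {X. \<forall>a b. X $ a $ b \<in> ?A (a, b)}"
      by (subst emeasure_distr) (auto intro!: arg_cong[where f = "emeasure ?N"])
    also have "\<dots> = (\<Prod>k\<in>UNIV. emeasure ?n (?A k))"
      by (rule box) simp
    also have "\<dots> = (\<Prod>k\<in>UNIV. if k = (i, j) then emeasure ?n B else 1)"
      using n.emeasure_space_1 by (intro prod.cong) auto
    finally show "emeasure (distr ?N borel (\<lambda>X. X $ i $ j)) B = emeasure ?n B" by simp
  qed simp
  have "distr ?N (\<Pi>\<^sub>M k\<in>UNIV. borel) (\<lambda>X. \<lambda>k\<in>UNIV. X $ fst k $ snd k) = (\<Pi>\<^sub>M k\<in>UNIV. ?n)"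
  proof (rule P.PiM_eqI)
    fix A :: "'p \<times> 'q \<Rightarrow> 'a set"
    assume "\<And>k. k \<in> UNIV \<Longrightarrow> A k \<in> sets ?n"
    then have A[measurable]: "\<And>k. A k \<in> sets borel" by simp
    have "emeasure (distr ?N (\<Pi>\<^sub>M k\<in>UNIV. borel) (\<lambda>X. \<lambda>k\<in>UNIV. X $ fst k $ snd k)) (Pi\<^sub>E UNIV A)
        = emeasure ?N {X. \<forall>i j. X $ i $ j \<in> A (i, j)}"
    proof (subst emeasure_distr)
      show "Pi\<^sub>E UNIV A \<in> sets (\<Pi>\<^sub>M k\<in>UNIV. borel)"
        by (intro sets_PiM_I_finite) simp_all
    qed (auto intro!: arg_cong[where f = "emeasure ?N"] measurable_restrict simp: PiE_def Pi_def)
    then show "emeasure (distr ?N (\<Pi>\<^sub>M k\<in>UNIV. borel) (\<lambda>X. \<lambda>k\<in>UNIV. X $ fst k $ snd k)) (Pi\<^sub>E UNIV A)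
        = (\<Prod>k\<in>UNIV. emeasure ?n (A k))"
      by (simp add: box)
  qed (simp_all cong: sets_PiM_cong)
  then show "N.indep_vars (\<lambda>_. borel) (\<lambda>(i, j) X. X $ i $ j) (UNIV :: ('p \<times> 'q) set)"
    by (subst N.indep_vars_iff_distr_eq_PiM') (simp_all add: case_prod_beta' marginal)
qed

lemma gaussian_matrix_measurable:
  fixes F :: "'o \<Rightarrow> complex^'q^'p"
  assumes "prob_space M" "gaussian_matrix \<FF> M F"
  shows "F \<in> borel_measurable M"
proof -
  interpret prob_space M by fact
  have "(\<lambda>\<omega>. F \<omega> $ i $ j) \<in> borel_measurable M" for i j
    using assms(2) unfolding gaussian_matrix_def indep_vars_def
    by (metis (mono_tags, lifting) UNIV_I case_prod_conv)
  then have "(\<lambda>\<omega>. \<chi> i j. F \<omega> $ i $ j) \<in> borel_measurable M"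
    by (intro borel_measurable_vec_lambda)
  then show ?thesis by (simp add: vec_lambda_eta)
qed

lemma gaussian_matrix_iff_distr:
  fixes F :: "'o \<Rightarrow> complex^'q^'p"
  assumes M: "prob_space M" and F[measurable]: "F \<in> borel_measurable M"
  shows "gaussian_matrix \<FF> M F \<longleftrightarrow>
    distr M (\<Pi>\<^sub>M k\<in>UNIV. borel) (\<lambda>\<omega>. \<lambda>k\<in>UNIV. F \<omega> $ fst k $ snd k) = (\<Pi>\<^sub>M k\<in>UNIV. standard_gaussian \<FF>) \<and>
    (\<forall>i j. distr M borel (\<lambda>\<omega>. F \<omega> $ i $ j) = standard_gaussian \<FF>)"
proof -
  interpret prob_space M by fact
  show ?thesis
    unfolding gaussian_matrix_def
    by (subst indep_vars_iff_distr_eq_PiM') (auto simp: case_prod_beta' cong: PiM_cong)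
qed

text \<open>
  Independence and the marginals say that the family of entries has a product law, so they fix the
  law of the matrix and can be recovered from it. A Gaussian matrix on an arbitrary probability
  space may therefore be replaced by the concrete one given by an isotropic normal vector.
\<close>

lemma gaussian_matrix_law_unique:
  fixes F :: "'o \<Rightarrow> complex^'q^'p" and F' :: "'o' \<Rightarrow> complex^'q^'p"
  assumes M: "prob_space M" "prob_space M'"
    and g: "gaussian_matrix \<FF> M F" "gaussian_matrix \<FF> M' F'"
  shows "distr M borel F = distr M' borel F'"
proof -
  let ?v = "\<lambda>f. \<chi> i j. f (i, j) :: complex^'q^'p"
  have law: "distr N borel H = distr (\<Pi>\<^sub>M k\<in>UNIV. standard_gaussian \<FF>) borel ?v"
    if N: "prob_space N" and H: "gaussian_matrix \<FF> N H" for N and H :: "'n \<Rightarrow> complex^'q^'p"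
  proof -
    have [measurable]: "H \<in> borel_measurable N" by (rule gaussian_matrix_measurable[OF N H])
    have "distr N borel H
        = distr (distr N (\<Pi>\<^sub>M k\<in>UNIV. borel) (\<lambda>\<omega>. \<lambda>k\<in>UNIV. H \<omega> $ fst k $ snd k)) borel ?v"
      by (subst distr_distr) (simp_all add: comp_def vec_lambda_eta)
    then show ?thesis
      using H[unfolded gaussian_matrix_iff_distr[OF N \<open>H \<in> borel_measurable N\<close>]] by simp
  qed
  show ?thesis using law[OF M(1) g(1)] law[OF M(2) g(2)] by simp
qed

lemma gaussian_matrix_law_cong:
  fixes F :: "'o \<Rightarrow> complex^'q^'p" and F' :: "'o' \<Rightarrow> complex^'q^'p"
  assumes M: "prob_space M" "prob_space M'"
    and F[measurable]: "F \<in> borel_measurable M" and g: "gaussian_matrix \<FF> M' F'"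
    and eq: "distr M borel F = distr M' borel F'"
  shows "gaussian_matrix \<FF> M F"
proof -
  note F'[measurable] = gaussian_matrix_measurable[OF M(2) g]
  have transfer: "distr M N (\<lambda>\<omega>. h (F \<omega>)) = distr M' N (\<lambda>\<omega>. h (F' \<omega>))"
    if "h \<in> measurable borel N" for h and N :: "'n measure"
    using distr_distr[OF that F] distr_distr[OF that F'] by (simp add: eq comp_def)
  have "distr M (\<Pi>\<^sub>M k\<in>UNIV. borel) (\<lambda>\<omega>. \<lambda>k\<in>UNIV. F \<omega> $ fst k $ snd k)
      = distr M' (\<Pi>\<^sub>M k\<in>UNIV. borel) (\<lambda>\<omega>. \<lambda>k\<in>UNIV. F' \<omega> $ fst k $ snd k)"
    by (rule transfer[of "\<lambda>X. \<lambda>k\<in>UNIV. X $ fst k $ snd k"]) measurable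
  moreover have "distr M borel (\<lambda>\<omega>. F \<omega> $ i $ j) = distr M' borel (\<lambda>\<omega>. F' \<omega> $ i $ j)" for i j
    by (rule transfer[of "\<lambda>X. X $ i $ j"]) measurable
  ultimately show ?thesis
    using g unfolding gaussian_matrix_iff_distr[OF M(2) F'] gaussian_matrix_iff_distr[OF M(1) F]
    by simp
qed

text \<open>
  Both fields at once: \<open>\<iota>\<close> embeds the Euclidean space carrying the scalars (\<open>\<real>\<close> itself, or
  \<open>\<complex>\<close>) into the complex numbers. A Gaussian matrix over \<open>\<FF>\<close> is the entrywise image
  of an isotropic normal vector under \<open>\<iota>\<close>, so that densities with respect to Lebesgue measure are
  available although a real Gaussian matrix has no density on the space of complex matrices.
\<close>

locale scalar_embedding =
  fixes \<FF> :: base_field and s :: real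
    and \<iota> :: "'a::euclidean_space \<Rightarrow> complex" and \<rho> :: "complex \<Rightarrow> 'a"
  assumes s_pos: "s > 0"
    and linear_\<iota>: "linear \<iota>" and norm_\<iota>: "\<And>a. norm (\<iota> a) = norm a"
    and range_\<iota>: "range \<iota> = scalars \<FF>"
    and linear_\<rho>: "linear \<rho>" and \<rho>_\<iota>: "\<And>a. \<rho> (\<iota> a) = a"
    and standard_gaussian: "standard_gaussian \<FF> = distr (isotropic_normal s) borel \<iota>"
begin

definition embed :: "'a^'q^'p \<Rightarrow> complex^'q^'p" where
  "embed X = (\<chi> i j. \<iota> (X $ i $ j))"

definition retract :: "complex^'q^'p \<Rightarrow> 'a^'q^'p" where
  "retract X = (\<chi> i j. \<rho> (X $ i $ j))"

lemma \<iota>_in_scalars: "\<iota> a \<in> scalars \<FF>"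
  using range_\<iota> by blast

lemma \<iota>_\<rho>: "z \<in> scalars \<FF> \<Longrightarrow> \<iota> (\<rho> z) = z"
  using range_\<iota> \<rho>_\<iota> by (metis imageE)

lemma matrix_over_embed: "matrix_over \<FF> (embed X)"
  by (simp add: matrix_over_def embed_def \<iota>_in_scalars)

lemma embed_retract: "matrix_over \<FF> X \<Longrightarrow> embed (retract X) = X"
  by (simp add: embed_def retract_def vec_eq_iff matrix_over_def \<iota>_\<rho>)

lemma retract_embed: "retract (embed X) = X"
  by (simp add: embed_def retract_def vec_eq_iff \<rho>_\<iota>)

lemma linear_embed: "linear (embed :: 'a^'q^'p \<Rightarrow> complex^'q^'p)"
  by (intro linearI) (simp_all add: embed_def vec_eq_iff linear_add[OF linear_\<iota>] linear_scale[OF linear_\<iota>])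

lemma linear_retract: "linear (retract :: complex^'q^'p \<Rightarrow> 'a^'q^'p)"
  by (intro linearI) (simp_all add: retract_def vec_eq_iff linear_add[OF linear_\<rho>] linear_scale[OF linear_\<rho>])

lemma borel_measurable_\<iota> [measurable]: "\<iota> \<in> borel_measurable borel"
  by (rule borel_measurable_linear[OF linear_\<iota>])

lemma borel_measurable_embed [measurable]: "embed \<in> borel_measurable borel"
  unfolding embed_def by measurable

lemma inner_embed: "embed X \<bullet> embed Y = X \<bullet> Y"
proof -
  have "\<iota> a \<bullet> \<iota> b = a \<bullet> b" for a b
    using linear_add[OF linear_\<iota>, of a b] by (simp add: dot_norm norm_\<iota> flip: linear_add[OF linear_\<iota>])
  then show ?thesis by (simp add: embed_def inner_vec_def)
qed

lemma gaussian_matrix_embed: "gaussian_matrix \<FF> (isotropic_normal s) (embed :: 'a^'q^'p \<Rightarrow> complex^'q^'p)"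
proof -
  interpret prob_space "isotropic_normal s :: ('a^'q^'p) measure"
    by (rule prob_space_isotropic_normal[OF s_pos])
  have "indep_vars (\<lambda>_. borel) (\<lambda>k X. \<iota> ((\<lambda>(i, j) X. X $ i $ j :: 'a) k X)) UNIV"
    by (rule indep_vars_compose2[OF isotropic_normal_entries_independent(1)[OF s_pos]]) simp
  moreover have "distr (isotropic_normal s) borel (\<lambda>X :: 'a^'q^'p. \<iota> (X $ i $ j)) = standard_gaussian \<FF>" for i j
  proof -
    have "distr (isotropic_normal s) borel (\<lambda>X :: 'a^'q^'p. \<iota> (X $ i $ j))
        = distr (distr (isotropic_normal s) borel (\<lambda>X :: 'a^'q^'p. X $ i $ j)) borel \<iota>"
      by (subst distr_distr) (simp_all add: comp_def)
    then show ?thesis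
      by (simp add: isotropic_normal_entries_independent(2)[OF s_pos] standard_gaussian)
  qed
  ultimately show ?thesis
    by (simp add: gaussian_matrix_def embed_def case_prod_beta')
qed

lemma distr_gaussian_matrix:
  fixes F :: "'o \<Rightarrow> complex^'q^'p"
  assumes "prob_space M" "gaussian_matrix \<FF> M F"
  shows "distr M borel F = distr (isotropic_normal s) borel embed"
  by (rule gaussian_matrix_law_unique[OF assms(1) prob_space_isotropic_normal[OF s_pos] assms(2) gaussian_matrix_embed])

text \<open>
  A coisometry \<open>P\<close> on complex matrices that preserves matrices over \<open>\<FF>\<close> restricts along \<open>embed\<close>
  to a coisometry of the real Euclidean spaces behind them. Only real-linear structure is involved,
  so transposition is covered as well as multiplication by a matrix.
\<close>

lemma gaussian_matrix_coisometry:
  fixes F :: "'o \<Rightarrow> complex^'q^'p"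
    and P :: "complex^'q^'p \<Rightarrow> complex^'t^'u" and S :: "complex^'t^'u \<Rightarrow> complex^'q^'p"
  assumes M: "prob_space M" and g: "gaussian_matrix \<FF> M F"
    and P: "linear P" and S: "linear S"
    and PS: "\<And>Y. P (S Y) = Y" and adj: "\<And>X Y. P X \<bullet> Y = X \<bullet> S Y"
    and over: "\<And>X. matrix_over \<FF> X \<Longrightarrow> matrix_over \<FF> (P X)" "\<And>Y. matrix_over \<FF> Y \<Longrightarrow> matrix_over \<FF> (S Y)"
  shows "gaussian_matrix \<FF> M (\<lambda>\<omega>. P (F \<omega>))"
proof (rule gaussian_matrix_law_cong[OF M prob_space_isotropic_normal[OF s_pos] _ gaussian_matrix_embed])
  note F[measurable] = gaussian_matrix_measurable[OF M g]
  have [measurable]: "P \<in> borel_measurable borel" by (rule borel_measurable_linear[OF P])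
  show "(\<lambda>\<omega>. P (F \<omega>)) \<in> borel_measurable M" by measurable
  let ?P = "\<lambda>X. retract (P (embed X))" and ?S = "\<lambda>Y. retract (S (embed Y))"
  have eP: "embed (?P X) = P (embed X)" and eS: "embed (?S Y) = S (embed Y)" for X Y
    by (simp_all add: embed_retract over matrix_over_embed)
  have lin: "linear ?P" "linear ?S"
    using linear_compose[OF linear_compose[OF linear_embed P] linear_retract]
      linear_compose[OF linear_compose[OF linear_embed S] linear_retract] by (simp_all add: comp_def)
  have [measurable]: "?P \<in> borel_measurable borel"
    by (rule borel_measurable_linear[OF lin(1)])
  have "distr (isotropic_normal s) borel ?P = isotropic_normal s"
  proof (rule isotropic_normal_coisometry[OF s_pos lin])
    show "?P (?S Y) = Y" for Y by (simp add: eS PS retract_embed)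
    show "?P X \<bullet> Y = X \<bullet> ?S Y" for X Y
      by (simp only: inner_embed[symmetric] eP eS adj)
  qed
  then have "distr (isotropic_normal s) borel (embed :: _ \<Rightarrow> complex^'t^'u)
      = distr (distr (isotropic_normal s) borel ?P) borel embed" by simp
  also have "\<dots> = distr (isotropic_normal s) borel (\<lambda>X. P (embed X))"
    by (subst distr_distr) (simp_all add: comp_def eP)
  also have "\<dots> = distr (distr (isotropic_normal s) borel embed) borel P"
    by (subst distr_distr) (simp_all add: comp_def)
  also have "\<dots> = distr M borel (\<lambda>\<omega>. P (F \<omega>))"
    unfolding distr_gaussian_matrix[OF M g, symmetric]
    by (subst distr_distr) (simp_all add: comp_def)
  finally show "distr M borel (\<lambda>\<omega>. P (F \<omega>)) = distr (isotropic_normal s) borel embed" ..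
qed

end

lemma finite_singular_shifts:
  fixes A :: "complex^'r^'r"
  shows "finite {t :: real. det (A + t *\<^sub>R mat 1) = 0}"
proof -
  \<comment> \<open>The reversed characteristic polynomial \<open>det (1 + x A)\<close>, which is not zero since its value at 0 is 1.\<close>
  define q where "q = (\<Sum>\<pi> | \<pi> permutes (UNIV :: 'r set).
    of_int (sign \<pi>) * (\<Prod>i\<in>UNIV. [:mat 1 $ i $ \<pi> i, A $ i $ \<pi> i:]))"
  have q: "poly q x = det (\<chi> i. mat 1 $ i + x *s A $ i)" for x
    by (simp add: q_def det_def poly_sum poly_prod)
  have "poly q 0 = det (mat 1 :: complex^'r^'r)"
    by (simp add: q vec_lambda_eta)
  then have "q \<noteq> 0" by auto
  then have fin: "finite {x. poly q x = 0}" by (rule poly_roots_finite)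
  have "{t. det (A + t *\<^sub>R mat 1) = 0} \<subseteq> insert 0 ((\<lambda>x. Re (inverse x)) ` {x. poly q x = 0})"
  proof
    fix t :: real
    assume "t \<in> {t. det (A + t *\<^sub>R mat 1) = 0}"
    then have t: "det (A + t *\<^sub>R mat 1) = 0" by simp
    show "t \<in> insert 0 ((\<lambda>x. Re (inverse x)) ` {x. poly q x = 0})"
    proof (cases "t = 0")
      case False
      let ?x = "inverse (complex_of_real t)"
      have "mat 1 $ i + ?x *s A $ i = ?x *s (A + t *\<^sub>R mat 1) $ i" for i
        using False by (simp add: vec_eq_iff mat_def field_simps scaleR_conv_of_real[where 'a = complex])
      then have "poly q ?x = (\<Prod>i\<in>(UNIV :: 'r set). ?x) * det (\<chi> i. (A + t *\<^sub>R mat 1) $ i)"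
        by (simp only: q) (rule det_rows_mul)
      then have "poly q ?x = 0" unfolding vec_lambda_eta t by simp
      moreover have "t = Re (inverse ?x)" by simp
      ultimately show ?thesis by blast
    qed simp
  qed
  then show ?thesis by (rule finite_subset) (use fin in simp)
qed

text \<open>
  A Gaussian matrix with at least as many rows as columns has full rank almost surely. With \<open>J\<close> a
  coordinate embedding, the matrix \<open>J\<^sup>* (X + t J) = J\<^sup>* X + t\<close> is, for fixed \<open>X\<close>, singular for
  at most finitely many real \<open>t\<close>. So the singular set, averaged over its translates along \<open>J\<close> and
  integrated over \<open>t\<close> first, has Lebesgue measure zero; as Lebesgue measure is invariant under
  translation, the singular set itself is null.
\<close>

lemma (in scalar_embedding) gaussian_matrix_AE_left_invertible:
  fixes F :: "'o \<Rightarrow> complex^'r^'k"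
  assumes M: "prob_space M" and g: "gaussian_matrix \<FF> M F" and card: "CARD('r) \<le> CARD('k)"
  shows "AE \<omega> in M. \<exists>L. L ** F \<omega> = mat 1"
proof -
  obtain f :: "'r \<Rightarrow> 'k" where f: "inj f"
    using card_le_inj[of "UNIV :: 'r set" "UNIV :: 'k set"] card by auto
  define J :: "complex^'r^'k" where "J = (\<chi> a b. if a = f b then 1 else 0)"
  define J' :: "'a^'r^'k" where "J' = retract J"
  define D where "D X = det (transpose J ** X)" for X
  have JJ: "transpose J ** J = mat 1"
  proof -
    have "(if k = f a then 1 else 0) * (if k = f b then 1 else 0)
        = (if k = f a then if a = b then 1 else 0 else (0 :: complex))" for k a b
      using injD[OF f] by auto
    then show ?thesis
      by (simp add: vec_eq_iff matrix_matrix_mult_def transpose_def J_def mat_def)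
  qed
  have J: "embed J' = J"
    unfolding J'_def by (rule embed_retract) (simp add: matrix_over_def J_def scalars_0 scalars_1)
  have [measurable]: "D \<in> borel_measurable borel"
    unfolding D_def det_def matrix_matrix_mult_def
    by (intro borel_measurable_continuous_onI continuous_intros)
  define Z where "Z = {X :: 'a^'r^'k. D (embed X) = 0}"
  have Z[measurable]: "Z \<in> sets borel"
  proof -
    have "{X \<in> space borel. D (embed X) = 0} \<in> sets (borel :: ('a^'r^'k) measure)" by measurable
    then show ?thesis by (simp add: Z_def)
  qed
  let ?I = "\<integral>\<^sup>+t. \<integral>\<^sup>+X. indicator Z (t *\<^sub>R J' + X) * indicator {0..1::real} t \<partial>lborel \<partial>lborel"
  have "?I = (\<integral>\<^sup>+t. emeasure lborel Z * indicator {0..1::real} t \<partial>lborel)"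
    by (intro nn_integral_cong)
       (simp add: nn_integral_multc nn_integral_lborel_translate[of "indicator Z"])
  also have "\<dots> = emeasure lborel Z"
    by (simp add: nn_integral_cmult)
  finally have I1: "?I = emeasure lborel Z" .
  have "?I = (\<integral>\<^sup>+X. \<integral>\<^sup>+t. indicator Z (t *\<^sub>R J' + X) * indicator {0..1::real} t \<partial>lborel \<partial>lborel)"
    by (rule lborel_pair.Fubini') measurable
  also have "\<dots> = (\<integral>\<^sup>+(X :: 'a^'r^'k). 0 \<partial>lborel)"
  proof (rule nn_integral_cong)
    fix X :: "'a^'r^'k"
    have D: "D (embed (t *\<^sub>R J' + X)) = det (transpose J ** embed X + t *\<^sub>R mat 1)" for t
    proof -
      have "embed (t *\<^sub>R J' + X) = t *\<^sub>R J + embed X"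
        by (simp add: linear_add[OF linear_embed] linear_scale[OF linear_embed] J)
      moreover have "transpose J ** (t *\<^sub>R J + embed X) = t *\<^sub>R (transpose J ** J) + transpose J ** embed X"
        by (simp add: vec_eq_iff matrix_matrix_mult_def distrib_left sum.distrib scaleR_sum_right)
      ultimately show ?thesis by (simp add: D_def JJ add.commute)
    qed
    have "{t. t *\<^sub>R J' + X \<in> Z} \<in> null_sets lborel"
      unfolding Z_def mem_Collect_eq D
      by (intro finite_imp_null_set_lborel finite_singular_shifts)
    then have "AE t in lborel. indicator Z (t *\<^sub>R J' + X) * indicator {0..1} t = (0 :: ennreal)"
      by (rule AE_I') (auto simp: indicator_def)
    then show "(\<integral>\<^sup>+t. indicator Z (t *\<^sub>R J' + X) * indicator {0..1::real} t \<partial>lborel) = (0 :: ennreal)"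
      by (subst nn_integral_0_iff_AE) simp_all
  qed
  finally have "emeasure lborel Z = 0" using I1 by simp
  then have "AE X in lborel. X \<notin> Z" by (intro AE_not_in null_setsI) simp_all
  then have "AE X in isotropic_normal s. X \<notin> Z"
    unfolding isotropic_normal_def by (subst AE_density) auto
  then have "AE Y in distr (isotropic_normal s) borel (embed :: 'a^'r^'k \<Rightarrow> _). D Y \<noteq> 0"
    by (subst AE_distr_iff) (simp_all add: Z_def)
  then have "AE Y in distr M borel F. D Y \<noteq> 0"
    by (simp only: distr_gaussian_matrix[OF M g])
  then have "AE \<omega> in M. D (F \<omega>) \<noteq> 0"
    by (rule AE_distrD[OF gaussian_matrix_measurable[OF M g]])
  then show ?thesis
  proof eventually_elim
    case (elim \<omega>)
    then obtain K where "K ** (transpose J ** F \<omega>) = mat 1"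
      by (auto simp: D_def invertible_det_nz[symmetric] invertible_def)
    then show ?case by (metis matrix_mul_assoc)
  qed
qed

lemma inner_matrix_eq: "A \<bullet> B = (\<Sum>i\<in>UNIV. \<Sum>j\<in>UNIV. Re (A $ i $ j * cnj (B $ i $ j)))"
  for A B :: "complex^'q^'p"
  by (simp add: inner_vec_def inner_complex_def)

lemma inner_matrix_trace: "A \<bullet> B = Re (trace (A ** conj_transpose B))"
  for A B :: "complex^'q^'p"
  by (simp add: inner_matrix_eq trace_def matrix_matrix_mult_def conj_transpose_def)

context scalar_embedding
begin

lemma gaussian_matrix_transpose:
  fixes F :: "'o \<Rightarrow> complex^'q^'p"
  assumes "prob_space M" "gaussian_matrix \<FF> M F"
  shows "gaussian_matrix \<FF> M (\<lambda>\<omega>. transpose (F \<omega>))"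
proof (rule gaussian_matrix_coisometry[OF assms, where S = transpose])
  fix X :: "complex^'q^'p" and Y :: "complex^'p^'q"
  have "(\<Sum>i\<in>UNIV. \<Sum>j\<in>UNIV. Re (X $ j $ i * cnj (Y $ i $ j)))
      = (\<Sum>j\<in>UNIV. \<Sum>i\<in>UNIV. Re (X $ j $ i * cnj (Y $ i $ j)))"
    by (rule sum.swap)
  then show "transpose X \<bullet> Y = X \<bullet> transpose Y"
    by (simp add: inner_matrix_eq transpose_def)
  show "linear (transpose :: complex^'q^'p \<Rightarrow> complex^'p^'q)" "linear (transpose :: complex^'p^'q \<Rightarrow> complex^'q^'p)"
    by (intro linearI; simp add: transpose_def vec_eq_iff)+
qed (simp_all add: matrix_over_transpose)

lemma gaussian_matrix_mult_isometry:
  fixes F :: "'o \<Rightarrow> complex^'q^'p" and U :: "complex^'r^'q"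
  assumes M: "prob_space M" "gaussian_matrix \<FF> M F"
    and U: "matrix_over \<FF> U" "conj_transpose U ** U = mat 1"
  shows "gaussian_matrix \<FF> M (\<lambda>\<omega>. F \<omega> ** U)"
proof (rule gaussian_matrix_coisometry[OF M, where P = "\<lambda>X. X ** U" and S = "\<lambda>Y. Y ** conj_transpose U"])
  have lin: "linear (\<lambda>X :: complex^'c^'p. X ** V)" for V :: "complex^'d^'c"
    by (intro linearI) (simp_all add: vec_eq_iff matrix_matrix_mult_def distrib_right sum.distrib scaleR_sum_right)
  show "linear (\<lambda>X :: complex^'q^'p. X ** U)" "linear (\<lambda>Y :: complex^'r^'p. Y ** conj_transpose U)"
    by (rule lin)+
  show "Y ** conj_transpose U ** U = Y" for Y :: "complex^'r^'p"
    using U(2) by (metis matrix_mul_assoc matrix_mul_rid)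
  show "(X ** U) \<bullet> Y = X \<bullet> (Y ** conj_transpose U)" for X :: "complex^'q^'p" and Y
    by (simp add: inner_matrix_trace conj_transpose_mult matrix_mul_assoc)
qed (intro matrix_over_mult matrix_over_conj_transpose U; assumption)+

end

lemma scalar_embedding_real: "scalar_embedding Real_Field (1 / 2) complex_of_real Re"
proof
  have "isotropic_normal (1 / 2) = density lborel (\<lambda>x. ennreal (std_normal_density x))"
    by (simp add: isotropic_normal_def isotropic_density_def[abs_def] std_normal_density_def
        real_sqrt_divide real_sqrt_mult)
  then show "standard_gaussian Real_Field = distr (isotropic_normal (1 / 2)) borel complex_of_real"
    by simp
qed (auto intro: linearI simp: Reals_def scaleR_conv_of_real)

lemma scalar_embedding_complex: "scalar_embedding Complex_Field 1 (\<lambda>z. z) (\<lambda>z. z)"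
proof
  have "isotropic_normal 1 = density lborel (\<lambda>z. ennreal (exp (- (cmod z)\<^sup>2) / pi))"
    by (simp add: isotropic_normal_def isotropic_density_def[abs_def] real_sqrt_divide power_divide)
  moreover have "distr (isotropic_normal 1) borel (\<lambda>z. z) = (isotropic_normal 1 :: complex measure)"
    by (rule measure_eqI) (simp_all add: emeasure_distr)
  ultimately show "standard_gaussian Complex_Field = distr (isotropic_normal 1) borel (\<lambda>z. z)"
    by simp
qed (auto intro: linearI)

section \<open>Gaussian matrices of full rank and rotated Gaussian matrices\<close>

lemma gaussian_matrix_transpose:
  assumes "prob_space M" "gaussian_matrix \<FF> M F"
  shows "gaussian_matrix \<FF> M (\<lambda>\<omega>. transpose (F \<omega>))"
  using scalar_embedding.gaussian_matrix_transpose[OF scalar_embedding_real]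
    scalar_embedding.gaussian_matrix_transpose[OF scalar_embedding_complex] assms
  by (cases \<FF>) auto

lemma gaussian_matrix_mult_isometry:
  assumes "prob_space M" "gaussian_matrix \<FF> M F"
    and "matrix_over \<FF> U" "conj_transpose U ** U = mat 1"
  shows "gaussian_matrix \<FF> M (\<lambda>\<omega>. F \<omega> ** U)"
  using scalar_embedding.gaussian_matrix_mult_isometry[OF scalar_embedding_real]
    scalar_embedding.gaussian_matrix_mult_isometry[OF scalar_embedding_complex] assms
  by (cases \<FF>) auto

lemma gaussian_matrix_AE_left_invertible:
  fixes F :: "'o \<Rightarrow> complex^'r^'k"
  assumes "prob_space M" "gaussian_matrix \<FF> M F" "CARD('r) \<le> CARD('k)"
  shows "AE \<omega> in M. \<exists>L. L ** F \<omega> = mat 1"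
  using scalar_embedding.gaussian_matrix_AE_left_invertible[OF scalar_embedding_real]
    scalar_embedding.gaussian_matrix_AE_left_invertible[OF scalar_embedding_complex] assms
  by (cases \<FF>) auto

text \<open>
  Multiplication from the left is multiplication of the transpose from the right by the entrywise
  conjugate of \<open>V\<close>, which is again an isometry over \<open>\<FF>\<close>.
\<close>

lemma gaussian_matrix_isometry_mult:
  fixes F :: "'o \<Rightarrow> complex^'q^'p" and V :: "complex^'r^'p"
  assumes M: "prob_space M" "gaussian_matrix \<FF> M F"
    and V: "matrix_over \<FF> V" "conj_transpose V ** V = mat 1"
  shows "gaussian_matrix \<FF> M (\<lambda>\<omega>. conj_transpose V ** F \<omega>)"
proof -
  let ?U = "transpose (conj_transpose V)"
  have "conj_transpose ?U = transpose V"
    by (simp add: conj_transpose_def transpose_def)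
  then have "conj_transpose ?U ** ?U = transpose (conj_transpose V ** V)"
    by (simp add: matrix_transpose_mul)
  then have "conj_transpose ?U ** ?U = mat 1" using V by simp
  moreover have "matrix_over \<FF> ?U"
    by (intro matrix_over_transpose matrix_over_conj_transpose V)
  ultimately have "gaussian_matrix \<FF> M (\<lambda>\<omega>. transpose (transpose (F \<omega>) ** ?U))"
    using gaussian_matrix_transpose[OF M] by (intro gaussian_matrix_transpose gaussian_matrix_mult_isometry M)
  then show ?thesis by (simp add: matrix_transpose_mul)
qed

lemma gaussian_matrix_AE_right_invertible:
  fixes F :: "'o \<Rightarrow> complex^'l^'r"
  assumes M: "prob_space M" "gaussian_matrix \<FF> M F" and card: "CARD('r) \<le> CARD('l)"
  shows "AE \<omega> in M. \<exists>R. F \<omega> ** R = mat 1"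
  using gaussian_matrix_AE_left_invertible[OF M(1) gaussian_matrix_transpose[OF M] card]
proof eventually_elim
  case (elim \<omega>)
  then obtain L where "L ** transpose (F \<omega>) = mat 1" by blast
  then have "transpose (L ** transpose (F \<omega>)) = mat 1" by simp
  then show ?case unfolding matrix_transpose_mul transpose_transpose by blast
qed

lemma sets_vimage_algebra_compose:
  assumes h: "h \<in> borel_measurable borel"
  shows "sets (vimage_algebra \<Omega> (\<lambda>\<omega>. h (Z \<omega>)) borel) \<subseteq> sets (vimage_algebra \<Omega> Z borel)"
proof
  fix A assume "A \<in> sets (vimage_algebra \<Omega> (\<lambda>\<omega>. h (Z \<omega>)) borel)"
  then obtain B where B: "B \<in> sets borel" "A = (\<lambda>\<omega>. h (Z \<omega>)) -` B \<inter> \<Omega>"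
    by (auto simp: sets_vimage_algebra2)
  then have "A = Z -` (h -` B) \<inter> \<Omega>" by auto
  moreover have "h -` B \<in> sets borel" using measurable_sets[OF h B(1)] by simp
  ultimately show "A \<in> sets (vimage_algebra \<Omega> Z borel)"
    by (auto simp: sets_vimage_algebra2)
qed

lemma independent_matrices_compose:
  fixes X :: "'o \<Rightarrow> complex^'q^'p" and Y :: "'o \<Rightarrow> complex^'t^'s"
  assumes M: "prob_space M" and ind: "independent_matrices M X Y"
    and f: "f \<in> borel_measurable borel" and g: "g \<in> borel_measurable borel"
  shows "independent_matrices M (\<lambda>\<omega>. f (X \<omega>)) (\<lambda>\<omega>. g (Y \<omega>))"
proof -
  interpret prob_space M by fact
  show ?thesis
    using ind unfolding independent_matrices_def indep_set_def
    by (rule indep_sets_mono_sets)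
       (auto split: bool.split dest: subsetD[OF sets_vimage_algebra_compose[OF f]]
          subsetD[OF sets_vimage_algebra_compose[OF g]])
qed

section \<open>Products of a fixed matrix with Gaussian matrices\<close>

lemma rank_left_invertible:
  fixes A :: "complex^'r^'p"
  assumes "L ** A = mat 1"
  shows "rank A = CARD('r)"
proof -
  have "vec.span (rows A) = UNIV"
    using assms matrix_left_invertible_span_rows_gen[of A] by blast
  then have "vec.dim (vec.span (rows A)) = CARD('r)"
    using vec_dim_card[where 'a = complex and 'n = 'r] by simp
  then show ?thesis by (simp add: row_rank_def_gen vec.dim_span)
qed

text \<open>
  The rows of \<open>U ** B\<close> are combinations of those of \<open>B\<close>, so the rank of \<open>B\<close> lies between that of
  the product and the number of its rows.
\<close>

lemma rank_right_factor:
  fixes U :: "complex^'r^'p" and B :: "complex^'q^'r"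
  assumes "rank (U ** B) = CARD('r)"
  shows "rank B = CARD('r)"
proof (rule antisym)
  have "rank B \<le> card (rows B)"
    unfolding row_rank_def_gen by (rule vec.dim_le_card') (simp add: rows_def full_SetCompr_eq)
  also have "\<dots> \<le> CARD('r)"
    using card_image_le[of "UNIV :: 'r set" "\<lambda>i. row i B"] by (simp add: rows_def full_SetCompr_eq)
  finally show "rank B \<le> CARD('r)" .
  have "row i (U ** B) = (\<Sum>k\<in>UNIV. U $ i $ k *s row k B)" for i
    by (simp add: vec_eq_iff row_def matrix_matrix_mult_def)
  moreover have "(\<Sum>k\<in>UNIV. U $ i $ k *s row k B) \<in> vec.span (rows B)" for i
    by (rule vec.span_sum, rule vec.span_scale, rule vec.span_base) (auto simp: rows_def)
  ultimately have "rows (U ** B) \<subseteq> vec.span (rows B)" by (auto simp: rows_def)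
  then have "vec.dim (rows (U ** B)) \<le> vec.dim (vec.span (rows B))"
    by (rule vec.dim_subset)
  then show "CARD('r) \<le> rank B"
    using assms by (simp add: row_rank_def_gen vec.dim_span)
qed

lemma spectral_norm_mult_le:
  assumes "spectral_norm A \<le> a" "spectral_norm B \<le> b"
  shows "spectral_norm (A ** B) \<le> a * b"
  using assms spectral_norm_mult[of A B] spectral_norm_nonneg[of A] spectral_norm_nonneg[of B]
  by (meson mult_mono order_trans)

lemma diagonal_matrix_inverse:
  assumes "\<And>i. \<sigma> i * \<tau> i = 1"
  shows "diagonal_matrix \<sigma> ** diagonal_matrix \<tau> = mat 1"
proof -
  have "(diagonal_matrix \<sigma> ** diagonal_matrix \<tau>) $ i $ j = mat 1 $ i $ j" for i j
  proof -
    have "complex_of_real (\<sigma> j) * complex_of_real (\<tau> j) = 1"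
      unfolding of_real_mult[symmetric] assms by simp
    then show ?thesis
      unfolding diagonal_matrix_mult_right by (simp add: diagonal_matrix_def mat_def)
  qed
  then show ?thesis by (simp add: vec_eq_iff)
qed

lemma diagonal_entry_le_spectral_norm: "\<bar>\<sigma> i\<bar> \<le> spectral_norm (diagonal_matrix \<sigma>)"
proof -
  have "diagonal_matrix \<sigma> *v axis i 1 = complex_of_real (\<sigma> i) *s axis i 1"
    by (auto simp: vec_eq_iff matrix_vector_mult_def diagonal_matrix_def axis_def
        if_distrib[of "\<lambda>t. _ * t"] cong: if_cong)
  then show ?thesis
    using norm_column_le_spectral_norm[of "diagonal_matrix \<sigma>" i]
    by (simp add: norm_scale_vec norm_axis_1)
qed

theorem theorem76:
  fixes \<FF> :: base_field
    and M :: "'o measure"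
    and G :: "'o \<Rightarrow> complex^'m^'k"
    and H :: "'o \<Rightarrow> complex^'l^'n"
    and W :: "complex^'n^'m"
    and c :: real
  assumes "prob_space M"
    and "CARD('r::{finite,linorder}) \<le> CARD('k)" and "CARD('k) \<le> CARD('m)"
    and "CARD('r) \<le> CARD('l)" and "CARD('l) \<le> CARD('n)"
    and "gaussian_matrix \<FF> M G" and "gaussian_matrix \<FF> M H"
    and "independent_matrices M G H"
    and "matrix_over \<FF> W" and "rank W = CARD('r)" and "well_conditioned c W"
  shows
    "(left_factor_gaussian TYPE('r) \<FF> c M (\<lambda>\<omega>. G \<omega> ** W) \<and>
      (\<exists>F :: 'o \<Rightarrow> complex^('r::{finite,linorder})^'k. gaussian_matrix \<FF> M F \<and>
        (AE \<omega> in M.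
          spectral_norm (G \<omega> ** W) \<le> spectral_norm W * spectral_norm (F \<omega>) \<and>
          spectral_norm (pinv (G \<omega> ** W)) \<le> spectral_norm (pinv W) * spectral_norm (pinv (F \<omega>)))))
     \<and>
     (right_factor_gaussian TYPE('r) \<FF> c M (\<lambda>\<omega>. W ** H \<omega>) \<and>
      (\<exists>F :: 'o \<Rightarrow> complex^'l^('r::{finite,linorder}). gaussian_matrix \<FF> M F \<and>
        (AE \<omega> in M.
          spectral_norm (W ** H \<omega>) \<le> spectral_norm W * spectral_norm (F \<omega>) \<and>
          spectral_norm (pinv (W ** H \<omega>)) \<le> spectral_norm (pinv W) * spectral_norm (pinv (F \<omega>)))))
     \<and>
     (diagonally_scaled_factor_gaussian TYPE('r) \<FF> c M (\<lambda>\<omega>. G \<omega> ** W ** H \<omega>) \<and>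
      (\<exists>(F :: 'o \<Rightarrow> complex^('r::{finite,linorder})^'k) (F' :: 'o \<Rightarrow> complex^'l^('r::{finite,linorder})).
        gaussian_matrix \<FF> M F \<and> gaussian_matrix \<FF> M F' \<and> independent_matrices M F F' \<and>
        (AE \<omega> in M.
          spectral_norm (G \<omega> ** W ** H \<omega>)
            \<le> spectral_norm W * spectral_norm (F \<omega>) * spectral_norm (F' \<omega>) \<and>
          spectral_norm (pinv (G \<omega> ** W ** H \<omega>))
            \<le> spectral_norm (pinv W) * spectral_norm (pinv (F \<omega>)) * spectral_norm (pinv (F' \<omega>)))))"
proof -
  have M: "prob_space M" by fact
  obtain U :: "complex^('r::{finite,linorder})^'m" and V :: "complex^('r::{finite,linorder})^'n" and \<sigma> :: "'r \<Rightarrow> real"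
    where over: "matrix_over \<FF> U" "matrix_over \<FF> V"
      and UU: "conj_transpose U ** U = mat 1" and VV: "conj_transpose V ** V = mat 1"
      and \<sigma>: "antimono \<sigma>" "\<And>i. \<sigma> i > 0"
      and W: "W = U ** diagonal_matrix \<sigma> ** conj_transpose V"
    using thin_singular_value_decomposition[of \<FF> W] \<open>matrix_over \<FF> W\<close> \<open>rank W = CARD('r)\<close>
    by metis
  define D where "D = diagonal_matrix \<sigma>"
  define E where "E = diagonal_matrix (\<lambda>i. inverse (\<sigma> i))"
  define U' where "U' = conj_transpose U"
  define V' where "V' = conj_transpose V"
  have UU': "U' ** U = mat 1" and VV': "V' ** V = mat 1"
    using UU VV by (simp_all add: U'_def V'_def)
  have UUx: "U' ** (U ** X) = X" for X :: "complex^'x^('r::{finite,linorder})"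
    using UU' by (simp add: matrix_mul_assoc)
  have VVx: "V' ** (V ** X) = X" for X :: "complex^'x^('r::{finite,linorder})"
    using VV' by (simp add: matrix_mul_assoc)
  have DE: "D ** E = mat 1" "E ** D = mat 1"
    unfolding D_def E_def using \<sigma>(2) by (auto intro!: diagonal_matrix_inverse simp: less_imp_neq[symmetric])
  have DEx: "D ** (E ** X) = X" "E ** (D ** X) = X" for X :: "complex^'x^('r::{finite,linorder})"
    using DE by (simp_all add: matrix_mul_assoc)
  note cancel = matrix_mul_assoc[symmetric] UU' VV' UUx VVx DE DEx
  have herm: "conj_transpose (U ** U') = U ** U'" "conj_transpose (V ** V') = V ** V'"
    by (simp_all add: conj_transpose_mult U'_def V'_def)
  \<comment> \<open>The nonrandom factors of \<open>W H\<close> and \<open>G W\<close>. As \<open>A = W V\<close> and \<open>B = U\<^sup>* W\<close>, neither they nor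
    their Moore--Penrose inverses have larger norms than those of \<open>W\<close>.\<close>
  define A where "A = U ** D"
  define B where "B = D ** V'"
  have W_U: "W = U ** B" and W_V: "W = A ** V'"
    by (simp_all add: W A_def B_def D_def V'_def matrix_mul_assoc)
  have pW: "pinv W = V ** E ** U'"
    by (rule pinv_eqI) (simp_all add: W_U B_def cancel herm)
  have pA: "pinv A = E ** U'"
    by (rule pinv_eqI) (simp_all add: A_def cancel herm)
  have pB: "pinv B = V ** E"
    by (rule pinv_eqI) (simp_all add: B_def cancel herm)
  have pD: "pinv D = E"
    by (rule pinv_eqI) (simp_all add: cancel)
  have nU: "spectral_norm U \<le> 1" "spectral_norm U' \<le> 1" "spectral_norm V \<le> 1" "spectral_norm V' \<le> 1"
    unfolding U'_def V'_def
    by (intro spectral_norm_isometry spectral_norm_coisometry UU VV)+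
  have nA: "spectral_norm A \<le> spectral_norm W"
    using spectral_norm_mult_le[OF order_refl nU(3), of W] by (simp add: W_V cancel)
  have nB: "spectral_norm B \<le> spectral_norm W"
    using spectral_norm_mult_le[OF nU(2) order_refl, of W] by (simp add: W_U cancel)
  have nD: "spectral_norm D \<le> spectral_norm W"
    using spectral_norm_mult_le[OF nB nU(3)] by (simp add: B_def cancel)
  have npA: "spectral_norm (pinv A) \<le> spectral_norm (pinv W)"
    using spectral_norm_mult_le[OF nU(4) order_refl, of "pinv W"] by (simp add: pA pW cancel)
  have npB: "spectral_norm (pinv B) \<le> spectral_norm (pinv W)"
    using spectral_norm_mult_le[OF order_refl nU(1), of "pinv W"] by (simp add: pB pW cancel)
  have nE: "spectral_norm E \<le> spectral_norm (pinv W)"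
    using spectral_norm_mult_le[OF npA nU(1)] by (simp add: pA cancel)
  have cond: "spectral_norm X * spectral_norm Y \<le> c"
    if "spectral_norm X \<le> spectral_norm W" "spectral_norm Y \<le> spectral_norm (pinv W)"
    for X :: "complex^'x1^'x2" and Y :: "complex^'y1^'y2"
    using mult_mono[OF that spectral_norm_nonneg spectral_norm_nonneg] \<open>well_conditioned c W\<close>
    by (simp add: well_conditioned_def condition_number_def)
  define F where "F \<omega> = G \<omega> ** U" for \<omega>
  define F' where "F' \<omega> = V' ** H \<omega>" for \<omega>
  have F: "gaussian_matrix \<FF> M F"
    unfolding F_def by (intro gaussian_matrix_mult_isometry M assms over UU)
  have F': "gaussian_matrix \<FF> M F'"
    unfolding F'_def V'_def by (intro gaussian_matrix_isometry_mult M assms over VV)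
  have left: "AE \<omega> in M. \<exists>L. L ** F \<omega> = mat 1"
    by (intro gaussian_matrix_AE_left_invertible[OF M F] assms)
  have right: "AE \<omega> in M. \<exists>R. F' \<omega> ** R = mat 1"
    by (intro gaussian_matrix_AE_right_invertible[OF M F'] assms)
  have ind: "independent_matrices M F F'"
    unfolding F_def F'_def
  proof (rule independent_matrices_compose[OF M \<open>independent_matrices M G H\<close>])
    show "(\<lambda>X. X ** U) \<in> borel_measurable borel" "(\<lambda>X. V' ** X) \<in> borel_measurable borel"
      by (intro borel_measurable_linear linearI;
          simp add: vec_eq_iff matrix_matrix_mult_def distrib_left distrib_right sum.distrib
            scaleR_sum_right)+
  qed
  have GW: "G \<omega> ** W = F \<omega> ** B" and WH: "W ** H \<omega> = A ** F' \<omega>"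
    and GWH: "G \<omega> ** W ** H \<omega> = F \<omega> ** D ** F' \<omega>" for \<omega>
    by (simp_all add: F_def F'_def W_U A_def B_def matrix_mul_assoc)

  have "left_factor_gaussian TYPE('r) \<FF> c M (\<lambda>\<omega>. G \<omega> ** W)"
    unfolding left_factor_gaussian_def
  proof (intro exI conjI ballI)
    show "rank B = CARD('r)"
      using rank_right_factor[of U B] W_U \<open>rank W = CARD('r)\<close> by simp
    show "well_conditioned c B"
      unfolding well_conditioned_def condition_number_def by (rule cond[OF nB npB])
  qed (rule F GW)+
  moreover have "AE \<omega> in M.
      spectral_norm (G \<omega> ** W) \<le> spectral_norm W * spectral_norm (F \<omega>) \<and>
      spectral_norm (pinv (G \<omega> ** W)) \<le> spectral_norm (pinv W) * spectral_norm (pinv (F \<omega>))"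
    using left
  proof eventually_elim
    case (elim \<omega>)
    then have "pinv (G \<omega> ** W) = pinv B ** pinv (F \<omega>)"
      unfolding GW by (elim exE, intro pinv_mult_full_rank[of _ _ _ "V ** E"]) (simp_all add: B_def cancel)
    then show ?case
      using spectral_norm_mult_le[OF order_refl nB, of "F \<omega>"] spectral_norm_mult_le[OF npB order_refl, of "pinv (F \<omega>)"]
      by (simp add: GW mult.commute)
  qed
  moreover have "right_factor_gaussian TYPE('r) \<FF> c M (\<lambda>\<omega>. W ** H \<omega>)"
    unfolding right_factor_gaussian_def
  proof (intro exI conjI ballI)
    show "rank A = CARD('r)"
      by (rule rank_left_invertible[of "E ** U'"]) (simp add: A_def cancel)
    show "well_conditioned c A"
      unfolding well_conditioned_def condition_number_def by (rule cond[OF nA npA])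
  qed (rule F' WH)+
  moreover have "AE \<omega> in M.
      spectral_norm (W ** H \<omega>) \<le> spectral_norm W * spectral_norm (F' \<omega>) \<and>
      spectral_norm (pinv (W ** H \<omega>)) \<le> spectral_norm (pinv W) * spectral_norm (pinv (F' \<omega>))"
    using right
  proof eventually_elim
    case (elim \<omega>)
    then have "pinv (W ** H \<omega>) = pinv (F' \<omega>) ** pinv A"
      unfolding WH by (elim exE, intro pinv_mult_full_rank[of "E ** U'"]) (simp_all add: A_def cancel)
    then show ?case
      using spectral_norm_mult_le[OF nA order_refl, of "F' \<omega>"] spectral_norm_mult_le[OF order_refl npA, of "pinv (F' \<omega>)"]
      by (simp add: WH mult.commute)
  qed
  moreover have "diagonally_scaled_factor_gaussian TYPE('r) \<FF> c M (\<lambda>\<omega>. G \<omega> ** W ** H \<omega>)"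
    unfolding diagonally_scaled_factor_gaussian_def
  proof (intro exI conjI ballI allI)
    \<comment> \<open>The extreme singular values and their inverses are entries of \<open>D\<close> and \<open>E\<close>, so their ratio is at most the
      product of the norms.\<close>
    let ?a = "Min UNIV :: 'r" and ?z = "Max UNIV :: 'r"
    have "\<sigma> ?a / \<sigma> ?z = \<bar>\<sigma> ?a\<bar> * \<bar>inverse (\<sigma> ?z)\<bar>"
      using \<sigma>(2)[of ?a] \<sigma>(2)[of ?z] by (simp add: divide_inverse)
    also have "\<dots> \<le> spectral_norm D * spectral_norm E"
      unfolding D_def E_def
      by (intro mult_mono diagonal_entry_le_spectral_norm spectral_norm_nonneg
          diagonal_entry_le_spectral_norm[of "\<lambda>i. inverse (\<sigma> i)"]) simp
    also have "\<dots> \<le> c" by (rule cond[OF nD nE])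
    finally show "\<sigma> ?a / \<sigma> ?z \<le> c" .
  qed (rule F F' ind \<sigma> GWH[unfolded D_def])+
  moreover have "AE \<omega> in M.
      spectral_norm (G \<omega> ** W ** H \<omega>) \<le> spectral_norm W * spectral_norm (F \<omega>) * spectral_norm (F' \<omega>) \<and>
      spectral_norm (pinv (G \<omega> ** W ** H \<omega>))
        \<le> spectral_norm (pinv W) * spectral_norm (pinv (F \<omega>)) * spectral_norm (pinv (F' \<omega>))"
    using left right
  proof eventually_elim
    case (elim \<omega>)
    then obtain L R where LR: "L ** F \<omega> = mat 1" "F' \<omega> ** R = mat 1" by blast
    have "E ** L ** (F \<omega> ** D) = E ** (L ** F \<omega>) ** D" by (simp add: matrix_mul_assoc)
    then have "E ** L ** (F \<omega> ** D) = mat 1" by (simp add: LR DE)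
    then have "pinv (G \<omega> ** W ** H \<omega>) = pinv (F' \<omega>) ** pinv (F \<omega> ** D)"
      unfolding GWH using LR(2) by (rule pinv_mult_full_rank)
    also have "pinv (F \<omega> ** D) = E ** pinv (F \<omega>)"
      using pinv_mult_full_rank[OF LR(1) DE(1)] by (simp add: pD)
    finally show ?case
      using spectral_norm_mult_le[OF spectral_norm_mult_le[OF order_refl nD, of "F \<omega>"] order_refl, of "F' \<omega>"]
        spectral_norm_mult_le[OF order_refl spectral_norm_mult_le[OF nE order_refl],
          of "pinv (F' \<omega>)" "pinv (F \<omega>)"]
      by (simp add: GWH mult_ac)
  qed
  ultimately show ?thesis using F F' ind by blast
qed

end
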